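(* Let $N\in\mathbb{N}$; for $i=1,\ldots,N$ let $(\mathcal{X}_i,d_{\mathcal{X}_i})$ be a compact metric space and $\mu_i$ a Borel probability measure on $\mathcal{X}_i$; let $\boldsymbol{\mathcal{X}}:=\mathcal{X}_1\times\cdots\times\mathcal{X}_N$ with metric $d_{\boldsymbol{\mathcal{X}}}(\boldsymbol{x},\boldsymbol{y}):=\sum_id_{\mathcal{X}_i}(x_i,y_i)$, and let $f:\boldsymbol{\mathcal{X}}\to\mathbb{R}$ be $L_f$-Lipschitz for some $L_f>0$. Let finite collections $\mathcal{G}_i=\{g_{i,1},\ldots,g_{i,m_i}\}$ of test functions be given such that one of the conditions (BSS-a), (BSS-b) holds, let $\mathtt{Oracle}$ be a global minimization oracle and $\epsilon_{\mathsf{LSIP}}>0$, and let $(\alpha^{\mathsf{UB}},\alpha^{\mathsf{LB}},\tilde{\mu},\tilde{\epsilon}_{\mathsf{sub}})$ be the output of Algorithm 2 with these inputs. Let $(\rho_i)_{i=1}^N$ satisfy $\rho_i\ge\overline{W}_{1,\mu_i}([\mu_i]_{\mathcal{G}_i})$ and set $\epsilon_{\mathsf{theo}}:=\epsilon_{\mathsf{LSIP}}+L_f\sum_{i=1}^N\rho_i$. Then: (i) $\alpha^{\mathsf{LB}}\le\inf_{\mu\in\Gamma(\mu_1,\ldots,\mu_N)}\int_{\boldsymbol{\mathcal{X}}}f\,\mathrm{d}\mu\le\alpha^{\mathsf{UB}}$; (ii) $\tilde{\mu}\in\Gamma(\mu_1,\ldots,\mu_N)$ is an $\tilde{\epsilon}_{\mathsf{sub}}$-optimal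 solution of $\inf_{\mu\in\Gamma(\mu_1,\ldots,\mu_N)}\int f\,\mathrm{d}\mu$, and $\tilde{\epsilon}_{\mathsf{sub}}\le\epsilon_{\mathsf{theo}}$. Moreover, suppose further that for each $i$, $\mathcal{X}_i$ is a compact subset of a Euclidean space with a norm-induced metric, and that for every $\epsilon_i>0$ there exist a bounded polyhedral cover $\mathfrak{C}_i$ of $\mathcal{X}_i$ with $\eta(\mathfrak{C}_i)\le\epsilon_i$ and a vertex interpolation function basis $\mathcal{G}_i$ for $\mathfrak{C}_i$ satisfying either (BSS-a') or (BSS-b). Then: (iii) for any $\epsilon>0$ and any $\epsilon_{\mathsf{LSIP}}\in(0,\epsilon)$, one can construct finite collections of test functions $\mathcal{G}_1,\ldots,\mathcal{G}_N$ such that the output of Algorithm 2 satisfies $\tilde{\epsilon}_{\mathsf{sub}}\le\epsilon$.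
   Context: Notation: $m:=\sum_im_i$, $\boldsymbol{g}_i(x_i):=(g_{i,1}(x_i),\ldots,g_{i,m_i}(x_i))^\top$, $\boldsymbol{g}(\boldsymbol{x}):=(\boldsymbol{g}_1(x_1)^\top,\ldots,\boldsymbol{g}_N(x_N)^\top)^\top$, $\bar{\boldsymbol{g}}$ the vector of $\int g_{i,j}\,\mathrm{d}\mu_i$ in the same order. Moment set: $[\mu_i]_{\mathcal{G}_i}$ is the set of Borel probability measures $\nu$ on $\mathcal{X}_i$ with $\int g\,\mathrm{d}\nu=\int g\,\mathrm{d}\mu_i$ for all $g\in\mathcal{G}_i$; $\overline{W}_{1,\mu_i}([\mu_i]_{\mathcal{G}_i}):=\sup_{\nu\in[\mu_i]_{\mathcal{G}_i}}W_1(\mu_i,\nu)$. $\Gamma(\cdot)$ denotes couplings; $\Gamma([\mu_1]_{\mathcal{G}_1},\ldots,[\mu_N]_{\mathcal{G}_N})$ the probability measures on $\boldsymbol{\mathcal{X}}$ whose $i$-th marginal is in $[\mu_i]_{\mathcal{G}_i}$. Polyhedral covers: a polyhedral cover of $\mathcal{Y}\subseteq\mathbb{R}^d$ is a finite collection $\mathfrak{C}$ of polyhedra each having an extreme point, whose union contains $\mathcal{Y}$, and such that any two members with non-empty intersection intersect in a common face; bounded if all members bounded; $V(C)$ extreme points, $\mathfrak{F}(\mathfrak{C})$ the non-empty faces of members, $V(\mathfrak{C}):=\bigcup V(C)$, $\eta(\mathfrak{C}):=\max_{C}\max_{\boldsymbol{v},\boldsymbol{v}'\in V(C)}\|\boldsymbol{v}-\boldsymbol{v}'\|$.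 A vertex interpolation function set is $\{g_{\boldsymbol{v}}:\bigcup_CC\to\mathbb{R}\}_{\boldsymbol{v}\in V(\mathfrak{C})}$ with $g_{\boldsymbol{v}}\ge0$, $g_{\boldsymbol{v}}(\boldsymbol{v}')=\mathbf{1}_{\{\boldsymbol{v}=\boldsymbol{v}'\}}$, $\sum_{\boldsymbol{v}\in V(F)}g_{\boldsymbol{v}}=1$ on each $F\in\mathfrak{F}(\mathfrak{C})$, and $g_{\boldsymbol{v}}=0$ on $F$ whenever $\boldsymbol{v}\notin V(F)$; a vertex interpolation function basis consists of all but one function of such a set. A simplicial cover of a bounded set is a bounded polyhedral cover whose members are $d$-simplices; for it, the barycentric vertex interpolation function set is $g_{\boldsymbol{v}}(\boldsymbol{x}):=\lambda^F_{\boldsymbol{v}}(\boldsymbol{x})$ if $\boldsymbol{v}\in V(F)$ and $0$ otherwise, where $F\in\mathfrak{F}(\mathfrak{C})$ is the unique face with $\boldsymbol{x}\in\operatorname{relint}(F)$ and $\boldsymbol{x}=\sum_{\boldsymbol{w}\in V(F)}\lambda^F_{\boldsymbol{w}}(\boldsymbol{x})\boldsymbol{w}$ with positive weights summing to 1. Conditions: (BSS-a) for each $i$, $\operatorname{supp}(\mu_i)=\mathcal{X}_i$, each $g_{i,j}$ is continuous, and there are $x_{i,1},\ldots,x_{i,m_i+1}\in\mathcal{X}_i$ with $\boldsymbol{g}_i(x_{i,1}),\ldots,\boldsymbol{g}_i(x_{i,m_i+1})$ affinely independent. (BSS-b) for each $i$, $\mathcal{X}_i$ is a compact subset of a Euclidean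 space with a norm-induced metric, $\mathfrak{C}_i$ is a bounded polyhedral cover of $\mathcal{X}_i$ with $V(\mathfrak{C}_i)\subseteq\mathcal{X}_i$, $\{g_{i,0},g_{i,1},\ldots,g_{i,m_i}\}$ is a vertex interpolation function set for $\mathfrak{C}_i$ with $\int g_{i,j}\,\mathrm{d}\mu_i>0$ for $j=0,\ldots,m_i$, and $\mathcal{G}_i=\{g_{i,1},\ldots,g_{i,m_i}\}$. (BSS-a') for each $i$, $\operatorname{supp}(\mu_i)=\mathcal{X}_i$ is a compact subset of a Euclidean space with norm-induced metric, $\mathfrak{C}_i$ is a simplicial cover of $\mathcal{X}_i$ with $\operatorname{int}(\mathcal{X}_i)\cap\operatorname{int}(C)\ne\emptyset$ for all $C\in\mathfrak{C}_i$, and $\mathcal{G}_i$ is obtained by removing one function from the barycentric vertex interpolation function set of $\mathfrak{C}_i$. Oracle: for each $\boldsymbol{y}\in\mathbb{R}^m$ returns $(\boldsymbol{x}^\star,\beta^\star)$ with $\boldsymbol{x}^\star$ a minimizer over $\boldsymbol{\mathcal{X}}$ of $f(\boldsymbol{x})-\langle\boldsymbol{g}(\boldsymbol{x}),\boldsymbol{y}\rangle$ and $\beta^\star$ the minimum value. Algorithm 1 (inputs: finite $\boldsymbol{\mathcal{X}}^{\dagger(0)}\subseteq\boldsymbol{\mathcal{X}}$, $\mathtt{Oracle}$, $\epsilon_{\mathsf{LSIP}}$): for $r=0,1,\ldots$: solve the LP $\alpha^{(r)}:=\max\{y_0+\langle\bar{\boldsymbol{g}},\boldsymbol{y}\rangle:y_0+\langle\boldsymbol{g}(\boldsymbol{x}),\boldsymbol{y}\rangle\le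 f(\boldsymbol{x})\ \forall\boldsymbol{x}\in\boldsymbol{\mathcal{X}}^{\dagger(r)}\}$ with optimizer $(y^{(r)}_0,\boldsymbol{y}^{(r)})$ and an optimizer $(\mu^{(r)}_{\boldsymbol{x}})_{\boldsymbol{x}\in\boldsymbol{\mathcal{X}}^{\dagger(r)}}$ of the dual LP $\min\{\sum_{\boldsymbol{x}}f(\boldsymbol{x})\mu_{\boldsymbol{x}}:\sum_{\boldsymbol{x}}\mu_{\boldsymbol{x}}=1,\ \sum_{\boldsymbol{x}}\boldsymbol{g}(\boldsymbol{x})\mu_{\boldsymbol{x}}=\bar{\boldsymbol{g}},\ \mu_{\boldsymbol{x}}\ge0\}$; call $\mathtt{Oracle}(\boldsymbol{y}^{(r)})$ obtaining $(\boldsymbol{x}^\star,s^{(r)})$; if $y_0^{(r)}-s^{(r)}\le\epsilon_{\mathsf{LSIP}}$ stop; otherwise choose a finite $\boldsymbol{\mathcal{X}}^\star\subset\boldsymbol{\mathcal{X}}$ containing $\boldsymbol{x}^\star$ and set $\boldsymbol{\mathcal{X}}^{\dagger(r+1)}:=\boldsymbol{\mathcal{X}}^{\dagger(r)}\cup\boldsymbol{\mathcal{X}}^\star$. At termination output $\alpha^{\mathsf{UB}}_{\mathsf{relax}}:=\alpha^{(r)}$, $\alpha^{\mathsf{LB}}_{\mathsf{relax}}:=\alpha^{(r)}-y^{(r)}_0+s^{(r)}$, $\hat y_0:=s^{(r)}$, $\hat{\boldsymbol{y}}:=\boldsymbol{y}^{(r)}$, $\hat{\mu}:=\sum_{\boldsymbol{x}\in\boldsymbol{\mathcal{X}}^{\dagger(r)}}\mu^{(r)}_{\boldsymbol{x}}\delta_{\boldsymbol{x}}$.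 Algorithm 2: construct a finite set $\boldsymbol{\mathcal{X}}^{\dagger(0)}\subseteq\boldsymbol{\mathcal{X}}$ such that the LP $\max\{y_0+\langle\bar{\boldsymbol{g}},\boldsymbol{y}\rangle:y_0+\langle\boldsymbol{g}(\boldsymbol{x}),\boldsymbol{y}\rangle\le f(\boldsymbol{x})\ \forall\boldsymbol{x}\in\boldsymbol{\mathcal{X}}^{\dagger(0)}\}$ has bounded superlevel sets; run Algorithm 1 to obtain $(\alpha^{\mathsf{UB}}_{\mathsf{relax}},\alpha^{\mathsf{LB}}_{\mathsf{relax}},\hat y_0,\hat{\boldsymbol{y}},\hat\mu)$; let $\tilde{\mu}\in R(\hat{\mu};\mu_1,\ldots,\mu_N)$; output $\alpha^{\mathsf{LB}}:=\alpha^{\mathsf{LB}}_{\mathsf{relax}}$, $\alpha^{\mathsf{UB}}:=\int f\,\mathrm{d}\tilde{\mu}$, $\tilde{\epsilon}_{\mathsf{sub}}:=\alpha^{\mathsf{UB}}-\alpha^{\mathsf{LB}}$, and $\tilde{\mu}$. Reassembly: $R(\hat{\mu};\mu_1,\ldots,\mu_N)$ is the set of $\tilde{\mu}\in\Gamma(\mu_1,\ldots,\mu_N)$ for which there is a probability measure $\gamma$ on $\mathcal{X}_1\times\cdots\times\mathcal{X}_N\times\bar{\mathcal{X}}_1\times\cdots\times\bar{\mathcal{X}}_N$ ($\bar{\mathcal{X}}_i$ a copy of $\mathcal{X}_i$) with marginal $\hat{\mu}$ on the first $N$ factors, $\tilde{\mu}$ on the last $N$ factors, and whose marginal on $\mathcal{X}_i\times\bar{\mathcal{X}}_i$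 is an optimal coupling (attaining $W_1$ for cost $d_{\mathcal{X}_i}$) of the $i$-th marginal of $\hat{\mu}$ and $\mu_i$. *)

theory Defs
  imports "HOL-Analysis.Analysis" "HOL-Probability.Probability"
begin

definition mtop :: "'a set \<Rightarrow> ('a \<Rightarrow> 'a \<Rightarrow> real) \<Rightarrow> 'a topology" where
  "mtop X d = Metric_space.mtopology X d"

definition borel_of :: "'a topology \<Rightarrow> 'a measure" where
  "borel_of T = sigma (topspace T) {U. openin T U}"

definition borel_prob_on :: "'a set \<Rightarrow> ('a \<Rightarrow> 'a \<Rightarrow> real) \<Rightarrow> 'a measure \<Rightarrow> bool" where
  "borel_prob_on X d \<mu> \<longleftrightarrow> prob_space \<mu> \<and> space \<mu> = X \<and> sets \<mu> = sets (borel_of (mtop X d))"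

definition msupport :: "'a set \<Rightarrow> ('a \<Rightarrow> 'a \<Rightarrow> real) \<Rightarrow> 'a measure \<Rightarrow> 'a set" where
  "msupport X d \<mu> = {x \<in> X. \<forall>U. openin (mtop X d) U \<and> x \<in> U \<longrightarrow> emeasure \<mu> U > 0}"

definition couplings :: "nat \<Rightarrow> (nat \<Rightarrow> 'a measure) \<Rightarrow> (nat \<Rightarrow> 'a) measure set" where
  "couplings N M = {\<pi>. sets \<pi> = sets (PiM {..<N} M) \<and> prob_space \<pi> \<and>
      (\<forall>i<N. distr \<pi> (M i) (\<lambda>x. x i) = M i)}"

definition couplings2 :: "'a measure \<Rightarrow> 'b measure \<Rightarrow> ('a \<times> 'b) measure set" where
  "couplings2 \<mu> \<nu> = {\<pi>. sets \<pi> = sets (\<mu> \<Otimes>\<^sub>M \<nu>) \<and> prob_space \<pi> \<and>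
      distr \<pi> \<mu> fst = \<mu> \<and> distr \<pi> \<nu> snd = \<nu>}"

definition W1 :: "('a \<Rightarrow> 'a \<Rightarrow> real) \<Rightarrow> 'a measure \<Rightarrow> 'a measure \<Rightarrow> real" where
  "W1 d \<mu> \<nu> = (INF \<pi>\<in>couplings2 \<mu> \<nu>. \<integral>z. d (fst z) (snd z) \<partial>\<pi>)"

definition moment_set :: "'a measure \<Rightarrow> (nat \<Rightarrow> 'a \<Rightarrow> real) \<Rightarrow> nat \<Rightarrow> 'a measure set" where
  "moment_set \<mu> g m = {\<nu>. prob_space \<nu> \<and> sets \<nu> = sets \<mu> \<and>
      (\<forall>j<m. (\<integral>x. g j x \<partial>\<nu>) = (\<integral>x. g j x \<partial>\<mu>))}"

definition Wbar :: "('a \<Rightarrow> 'a \<Rightarrow> real) \<Rightarrow> 'a measure \<Rightarrow> (nat \<Rightarrow> 'a \<Rightarrow> real) \<Rightarrow> nat \<Rightarrow> real" where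
  "Wbar d \<mu> g m = (SUP \<nu>\<in>moment_set \<mu> g m. W1 d \<mu> \<nu>)"

text \<open>Vectors y in R^m, m = sum_i m_i, are represented as y i j (i<N, j<m i), zero elsewhere.
  The test function g_{i,j+1} of the paper is g i j.\<close>
definition yspace :: "nat \<Rightarrow> (nat \<Rightarrow> nat) \<Rightarrow> (nat \<Rightarrow> nat \<Rightarrow> real) set" where
  "yspace N m = {y. \<forall>i j. \<not> (i < N \<and> j < m i) \<longrightarrow> y i j = 0}"

definition ginner :: "nat \<Rightarrow> (nat \<Rightarrow> nat) \<Rightarrow> (nat \<Rightarrow> nat \<Rightarrow> 'a \<Rightarrow> real) \<Rightarrow> (nat \<Rightarrow> 'a) \<Rightarrow> (nat \<Rightarrow> nat \<Rightarrow> real) \<Rightarrow> real" where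
  "ginner N m g x y = (\<Sum>i<N. \<Sum>j<m i. g i j (x i) * y i j)"

definition gbar :: "(nat \<Rightarrow> 'a measure) \<Rightarrow> (nat \<Rightarrow> nat \<Rightarrow> 'a \<Rightarrow> real) \<Rightarrow> nat \<Rightarrow> nat \<Rightarrow> real" where
  "gbar M g i j = (\<integral>x. g i j x \<partial>(M i))"

definition lp_obj :: "nat \<Rightarrow> (nat \<Rightarrow> nat) \<Rightarrow> (nat \<Rightarrow> nat \<Rightarrow> real) \<Rightarrow> real \<Rightarrow> (nat \<Rightarrow> nat \<Rightarrow> real) \<Rightarrow> real" where
  "lp_obj N m gb y0 y = y0 + (\<Sum>i<N. \<Sum>j<m i. gb i j * y i j)"

definition lp_feas :: "nat \<Rightarrow> (nat \<Rightarrow> nat) \<Rightarrow> (nat \<Rightarrow> nat \<Rightarrow> 'a \<Rightarrow> real) \<Rightarrow> ((nat \<Rightarrow> 'a) \<Rightarrow> real)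
      \<Rightarrow> (nat \<Rightarrow> 'a) set \<Rightarrow> (real \<times> (nat \<Rightarrow> nat \<Rightarrow> real)) set" where
  "lp_feas N m g f S = {(y0, y). y \<in> yspace N m \<and> (\<forall>x\<in>S. y0 + ginner N m g x y \<le> f x)}"

definition lp_opt where
  "lp_opt N m g gb f S y0 y \<longleftrightarrow> (y0, y) \<in> lp_feas N m g f S \<and>
     (\<forall>(z0, z)\<in>lp_feas N m g f S. lp_obj N m gb z0 z \<le> lp_obj N m gb y0 y)"

definition dual_feas where
  "dual_feas N m g gb S (w :: (nat \<Rightarrow> 'a) \<Rightarrow> real) \<longleftrightarrow> (\<forall>x\<in>S. w x \<ge> 0) \<and> (\<Sum>x\<in>S. w x) = 1 \<and>
     (\<forall>i<N. \<forall>j<m i. (\<Sum>x\<in>S. g i j (x i) * w x) = gb i j)"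

definition dual_opt where
  "dual_opt N m g gb f S w \<longleftrightarrow> dual_feas N m g gb S w \<and>
     (\<forall>w'. dual_feas N m g gb S w' \<longrightarrow> (\<Sum>x\<in>S. f x * w x) \<le> (\<Sum>x\<in>S. f x * w' x))"

definition lp_bounded_superlevel where
  "lp_bounded_superlevel N m g gb f X0 \<longleftrightarrow>
     (\<forall>c. \<exists>B. \<forall>(y0, y)\<in>lp_feas N m g f X0. lp_obj N m gb y0 y \<ge> c \<longrightarrow>
         \<bar>y0\<bar> \<le> B \<and> (\<forall>i<N. \<forall>j<m i. \<bar>y i j\<bar> \<le> B))"

definition is_oracle where
  "is_oracle Xp N m g f (Or :: (nat \<Rightarrow> nat \<Rightarrow> real) \<Rightarrow> (nat \<Rightarrow> 'a) \<times> real) \<longleftrightarrow>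
     (\<forall>y\<in>yspace N m. fst (Or y) \<in> Xp \<and> snd (Or y) = f (fst (Or y)) - ginner N m g (fst (Or y)) y \<and>
        (\<forall>x\<in>Xp. snd (Or y) \<le> f x - ginner N m g x y))"

text \<open>A terminating run of Algorithm 1 and its output (alpha_UB_relax, alpha_LB_relax, y0hat, yhat, mu_hat),
  where mu_hat = sum over S of w x delta_x.\<close>
definition alg1_output where
  "alg1_output Xp N m g gb f Or epsL X0 aUBr aLBr hy0 hy S w \<longleftrightarrow>
    (\<exists>(Xs :: nat \<Rightarrow> (nat \<Rightarrow> 'a) set) y0s ys ws Xst R.
       Xs 0 = X0 \<and>
       (\<forall>r\<le>R. lp_opt N m g gb f (Xs r) (y0s r) (ys r) \<and> dual_opt N m g gb f (Xs r) (ws r)) \<and>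
       (\<forall>r<R. y0s r - snd (Or (ys r)) > epsL \<and> finite (Xst r) \<and> Xst r \<subseteq> Xp \<and>
              fst (Or (ys r)) \<in> Xst r \<and> Xs (Suc r) = Xs r \<union> Xst r) \<and>
       y0s R - snd (Or (ys R)) \<le> epsL \<and>
       aUBr = lp_obj N m gb (y0s R) (ys R) \<and>
       aLBr = lp_obj N m gb (y0s R) (ys R) - y0s R + snd (Or (ys R)) \<and>
       hy0 = snd (Or (ys R)) \<and> hy = ys R \<and> S = Xs R \<and> w = ws R)"

definition discrete_meas :: "'b measure \<Rightarrow> 'b set \<Rightarrow> ('b \<Rightarrow> real) \<Rightarrow> 'b measure" where
  "discrete_meas \<Omega> S w = measure_of (space \<Omega>) (sets \<Omega>) (\<lambda>A. \<Sum>x\<in>S. ennreal (w x) * indicator A x)"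

definition reassembly :: "nat \<Rightarrow> (nat \<Rightarrow> 'a \<Rightarrow> 'a \<Rightarrow> real) \<Rightarrow> (nat \<Rightarrow> 'a measure) \<Rightarrow> (nat \<Rightarrow> 'a) measure
     \<Rightarrow> (nat \<Rightarrow> 'a) measure set" where
  "reassembly N d M \<mu>h = {\<mu>t \<in> couplings N M. \<exists>\<gamma>.
      sets \<gamma> = sets (PiM {..<N} M \<Otimes>\<^sub>M PiM {..<N} M) \<and> prob_space \<gamma> \<and>
      distr \<gamma> (PiM {..<N} M) fst = \<mu>h \<and> distr \<gamma> (PiM {..<N} M) snd = \<mu>t \<and>
      (\<forall>i<N. distr \<gamma> (M i \<Otimes>\<^sub>M M i) (\<lambda>z. (fst z i, snd z i))
                \<in> couplings2 (distr \<mu>h (M i) (\<lambda>x. x i)) (M i) \<and>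
             (\<integral>z. d i (fst z) (snd z) \<partial>(distr \<gamma> (M i \<Otimes>\<^sub>M M i) (\<lambda>z. (fst z i, snd z i))))
               = W1 (d i) (distr \<mu>h (M i) (\<lambda>x. x i)) (M i))}"

definition alg2_output where
  "alg2_output N X d M m g f Or epsL aUB aLB mut epsSub \<longleftrightarrow>
    (\<exists>X0 aUBr aLBr hy0 hy S w. finite X0 \<and> X0 \<subseteq> PiE {..<N} X \<and>
       lp_bounded_superlevel N m g (gbar M g) f X0 \<and>
       alg1_output (PiE {..<N} X) N m g (gbar M g) f Or epsL X0 aUBr aLBr hy0 hy S w \<and>
       mut \<in> reassembly N d M (discrete_meas (PiM {..<N} M) S w) \<and>
       aLB = aLBr \<and> aUB = (\<integral>x. f x \<partial>mut) \<and> epsSub = aUB - aLB)"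

definition BSSa_i :: "'a set \<Rightarrow> ('a \<Rightarrow> 'a \<Rightarrow> real) \<Rightarrow> 'a measure \<Rightarrow> nat \<Rightarrow> (nat \<Rightarrow> 'a \<Rightarrow> real) \<Rightarrow> bool" where
  "BSSa_i X d \<mu> m g \<longleftrightarrow> msupport X d \<mu> = X \<and>
     (\<forall>j<m. continuous_map (mtop X d) euclideanreal (g j)) \<and>
     (\<exists>p. (\<forall>k\<le>m. p k \<in> X) \<and>
        (\<forall>c. (\<Sum>k\<le>m. c k) = 0 \<and> (\<forall>j<m. (\<Sum>k\<le>m. c k * g j (p k)) = 0) \<longrightarrow> (\<forall>k\<le>m. c k = 0)))"

definition is_norm :: "('e::real_vector \<Rightarrow> real) \<Rightarrow> bool" where
  "is_norm nrm \<longleftrightarrow> (\<forall>x. nrm x \<ge> 0) \<and> (\<forall>x. nrm x = 0 \<longleftrightarrow> x = 0) \<and>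
     (\<forall>c x. nrm (c *\<^sub>R x) = \<bar>c\<bar> * nrm x) \<and> (\<forall>x y. nrm (x + y) \<le> nrm x + nrm y)"

text \<open>(X,d) is (isometric to) a subset of a Euclidean space S (a linear subspace of 'e) whose metric is
  induced by a norm.\<close>
definition euc_repr :: "'a set \<Rightarrow> ('a \<Rightarrow> 'a \<Rightarrow> real) \<Rightarrow> ('a \<Rightarrow> 'e::euclidean_space) \<Rightarrow> ('e \<Rightarrow> real) \<Rightarrow> 'e set \<Rightarrow> bool" where
  "euc_repr X d \<phi> nrm S \<longleftrightarrow> is_norm nrm \<and> subspace S \<and> \<phi> ` X \<subseteq> S \<and> inj_on \<phi> X \<and>
     (\<forall>x\<in>X. \<forall>y\<in>X. d x y = nrm (\<phi> x - \<phi> y))"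

definition vertices :: "'e::euclidean_space set \<Rightarrow> 'e set" where
  "vertices C = {v. v extreme_point_of C}"

definition polyhedral_cover :: "'e::euclidean_space set set \<Rightarrow> 'e set \<Rightarrow> bool" where
  "polyhedral_cover \<CC> Y \<longleftrightarrow> finite \<CC> \<and> (\<forall>C\<in>\<CC>. polyhedron C \<and> vertices C \<noteq> {}) \<and> Y \<subseteq> \<Union>\<CC> \<and>
     (\<forall>C\<in>\<CC>. \<forall>C'\<in>\<CC>. C \<inter> C' \<noteq> {} \<longrightarrow> (C \<inter> C') face_of C \<and> (C \<inter> C') face_of C')"

definition bounded_polyhedral_cover :: "'e::euclidean_space set set \<Rightarrow> 'e set \<Rightarrow> bool" where
  "bounded_polyhedral_cover \<CC> Y \<longleftrightarrow> polyhedral_cover \<CC> Y \<and> (\<forall>C\<in>\<CC>. bounded C)"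

definition cover_faces :: "'e::euclidean_space set set \<Rightarrow> 'e set set" where
  "cover_faces \<CC> = {F. F \<noteq> {} \<and> (\<exists>C\<in>\<CC>. F face_of C)}"

definition cover_vertices :: "'e::euclidean_space set set \<Rightarrow> 'e set" where
  "cover_vertices \<CC> = (\<Union>C\<in>\<CC>. vertices C)"

definition eta :: "('e::euclidean_space \<Rightarrow> real) \<Rightarrow> 'e set set \<Rightarrow> real" where
  "eta nrm \<CC> = Max ((\<lambda>C. Max {nrm (v - v') | v v'. v \<in> vertices C \<and> v' \<in> vertices C}) ` \<CC>)"

definition vif_set :: "'e::euclidean_space set set \<Rightarrow> ('e \<Rightarrow> 'e \<Rightarrow> real) \<Rightarrow> bool" where
  "vif_set \<CC> h \<longleftrightarrow>
     (\<forall>v\<in>cover_vertices \<CC>. \<forall>x\<in>\<Union>\<CC>. h v x \<ge> 0) \<and>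
     (\<forall>v\<in>cover_vertices \<CC>. \<forall>v'\<in>cover_vertices \<CC>. h v v' = (if v = v' then 1 else 0)) \<and>
     (\<forall>F\<in>cover_faces \<CC>. \<forall>x\<in>F. (\<Sum>v\<in>vertices F. h v x) = 1) \<and>
     (\<forall>F\<in>cover_faces \<CC>. \<forall>v\<in>cover_vertices \<CC> - vertices F. \<forall>x\<in>F. h v x = 0)"

definition barycentric_vif :: "'e::euclidean_space set set \<Rightarrow> ('e \<Rightarrow> 'e \<Rightarrow> real) \<Rightarrow> bool" where
  "barycentric_vif \<CC> h \<longleftrightarrow>
     (\<forall>F\<in>cover_faces \<CC>. \<forall>x\<in>rel_interior F.
        (\<forall>w\<in>vertices F. h w x > 0) \<and> (\<Sum>w\<in>vertices F. h w x) = 1 \<and>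
        (\<Sum>w\<in>vertices F. h w x *\<^sub>R w) = x \<and>
        (\<forall>v\<in>cover_vertices \<CC> - vertices F. h v x = 0))"

definition simplicial_cover :: "'e::euclidean_space set \<Rightarrow> 'e set set \<Rightarrow> 'e set \<Rightarrow> bool" where
  "simplicial_cover S \<CC> Y \<longleftrightarrow> bounded_polyhedral_cover \<CC> Y \<and>
     (\<forall>C\<in>\<CC>. C \<subseteq> S \<and> int (dim S) simplex C)"

text \<open>(BSS-b) for one index i, with cover \<CC> in the Euclidean space S containing phi(X).
  g j (j < m) is g_{i,j+1}; g_{i,0} is the removed function h (vt 0).\<close>
definition BSSb_i :: "'a set \<Rightarrow> ('a \<Rightarrow> 'a \<Rightarrow> real) \<Rightarrow> 'a measure \<Rightarrow> nat \<Rightarrow> (nat \<Rightarrow> 'a \<Rightarrow> real)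
     \<Rightarrow> ('a \<Rightarrow> 'e::euclidean_space) \<Rightarrow> ('e \<Rightarrow> real) \<Rightarrow> 'e set \<Rightarrow> 'e set set \<Rightarrow> bool" where
  "BSSb_i X d \<mu> m g \<phi> nrm S \<CC> \<longleftrightarrow> euc_repr X d \<phi> nrm S \<and>
     bounded_polyhedral_cover \<CC> (\<phi> ` X) \<and> (\<forall>C\<in>\<CC>. C \<subseteq> S) \<and> cover_vertices \<CC> \<subseteq> \<phi> ` X \<and>
     (\<exists>h vt. vif_set \<CC> h \<and> bij_betw vt {..m} (cover_vertices \<CC>) \<and>
        (\<forall>j\<le>m. (\<integral>x. h (vt j) (\<phi> x) \<partial>\<mu>) > 0) \<and>
        (\<forall>j<m. \<forall>x\<in>X. g j x = h (vt (Suc j)) (\<phi> x)))"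

definition BSSa'_i :: "'a set \<Rightarrow> ('a \<Rightarrow> 'a \<Rightarrow> real) \<Rightarrow> 'a measure \<Rightarrow> nat \<Rightarrow> (nat \<Rightarrow> 'a \<Rightarrow> real)
     \<Rightarrow> ('a \<Rightarrow> 'e::euclidean_space) \<Rightarrow> ('e \<Rightarrow> real) \<Rightarrow> 'e set \<Rightarrow> 'e set set \<Rightarrow> bool" where
  "BSSa'_i X d \<mu> m g \<phi> nrm S \<CC> \<longleftrightarrow> euc_repr X d \<phi> nrm S \<and> msupport X d \<mu> = X \<and>
     simplicial_cover S \<CC> (\<phi> ` X) \<and>
     (\<forall>C\<in>\<CC>. ((top_of_set S) interior_of (\<phi> ` X)) \<inter> ((top_of_set S) interior_of C) \<noteq> {}) \<and>
     (\<exists>h vt v0. barycentric_vif \<CC> h \<and> v0 \<in> cover_vertices \<CC> \<and>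
        bij_betw vt {..<m} (cover_vertices \<CC> - {v0}) \<and>
        (\<forall>j<m. \<forall>x\<in>X. g j x = h (vt j) (\<phi> x)))"

end

theory Submission
  imports Defs
begin

text \<open>The oracle value \<open>s\<close> satisfies \<open>s + \<langle>g(x), y\<rangle> \<le> f(x)\<close> on the whole product space, so
  integrating against any coupling gives the lower bound. By strong LP duality the discrete measure
  has cost within \<open>\<epsilon>\<^sub>L\<^sub>S\<^sub>I\<^sub>P\<close> of that bound; replacing its marginals by the prescribed ones along
  optimal couplings costs at most \<open>L\<close> times the sum of the \<open>W\<^sub>1\<close> distances, and the discrete
  marginals lie in the moment sets.

  For a vertex interpolation family on a cover of mesh \<open>\<eta>\<close>, two measures with equal moments are
  joined by a mixture of products supported on pairs that are both within \<open>\<eta>\<close> of a common vertex,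
  so the moment set has \<open>W\<^sub>1\<close> radius at most \<open>2 \<eta>\<close>.\<close>

subsection \<open>Linear programming duality\<close>

text \<open>Two difficulties shape the argument. The metrics live on carrier sets and the cost is
  integrated over the product sigma-algebra, so measurability of the metric and of \<open>f\<close>
  is not immediate from continuity; compactness provides countable dense sets that turn both into
  countable infima of functions built from single coordinates. Moreover, \<open>vif_set\<close> does
  not ask for continuous interpolation functions: under \<open>BSSb_i\<close> measurability is read
  off from positive integrals, under \<open>BSSa'_i\<close> from continuity of barycentric
  coordinates. The gluing coupling is written as a density with respect to the product measure, so
  its marginals follow from Fubini, and division by zero disposes of functions without mass. The
  radius \<open>2 \<eta>\<close> has a factor 2 because two points sharing a vertex need not share a
  cell.\<close>

text \<open>Elimination of one constraint at a time, by induction on \<open>S\<close>, takes the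
  place of separation from a closed cone. Vectors are functions on the finite index set
  \<open>I\<close>.\<close>

lemma farkas_bartl:
  fixes A :: "'s \<Rightarrow> 'i \<Rightarrow> real" and c :: "'i \<Rightarrow> real"
  assumes "finite S" and I: "finite I"
    and "\<And>y. (\<And>s. s \<in> S \<Longrightarrow> (\<Sum>i\<in>I. A s i * y i) \<le> 0) \<Longrightarrow> (\<Sum>i\<in>I. c i * y i) \<le> 0"
  shows "\<exists>w. (\<forall>s\<in>S. 0 \<le> w s) \<and> (\<forall>i\<in>I. (\<Sum>s\<in>S. w s * A s i) = c i)"
  using assms(1,3)
proof (induction S arbitrary: A c rule: finite_induct)
  case empty
  \<comment> \<open>Without constraints the premise holds for every vector; testing it with
    \<open>c\<close> itself forces \<open>c\<close> to vanish on \<open>I\<close>.\<close>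
  have "(\<Sum>i\<in>I. c i * c i) \<le> 0" using empty.prems[of c] by simp
  then have "(\<Sum>i\<in>I. c i * c i) = 0" by (simp add: sum_nonneg order_antisym)
  then have "\<forall>i\<in>I. c i = 0" using I by (simp add: sum_nonneg_eq_0_iff)
  then show ?case by simp
next
  case (insert t S)
  show ?case
  proof (cases "\<forall>y. (\<forall>s\<in>S. (\<Sum>i\<in>I. A s i * y i) \<le> 0) \<longrightarrow> (\<Sum>i\<in>I. c i * y i) \<le> 0")
    case True
    then obtain w where w: "\<forall>s\<in>S. 0 \<le> w s" "\<forall>i\<in>I. (\<Sum>s\<in>S. w s * A s i) = c i"
      using insert.IH[of A c] by blast
    have "(\<Sum>s\<in>S. (w(t := 0)) s * A s i) = (\<Sum>s\<in>S. w s * A s i)" for i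
      using insert.hyps by (intro sum.cong) auto
    then show ?thesis using w insert.hyps
      by (intro exI[of _ "w(t := 0)"]) auto
  next
    case False
    then obtain z where z: "\<forall>s\<in>S. (\<Sum>i\<in>I. A s i * z i) \<le> 0" "(\<Sum>i\<in>I. c i * z i) > 0"
      by (auto simp: not_le)
    \<comment> \<open>Otherwise \<open>z\<close> would satisfy the constraint \<open>t\<close> as
      well, and the premise would contradict its positive value under \<open>c\<close>. This permits
      rescaling \<open>z\<close> to the value 1 under \<open>A t\<close>.\<close>
    have tz: "(\<Sum>i\<in>I. A t i * z i) > 0"
      using insert.prems[of z] z by (metis insertE not_le)
    define x where "x i = z i / (\<Sum>i\<in>I. A t i * z i)" for i
    have sc: "(\<Sum>i\<in>I. b i * x i) = (\<Sum>i\<in>I. b i * z i) / (\<Sum>i\<in>I. A t i * z i)" for b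
      unfolding x_def by (simp add: sum_divide_distrib)
    have x: "\<forall>s\<in>S. (\<Sum>i\<in>I. A s i * x i) \<le> 0" "(\<Sum>i\<in>I. c i * x i) > 0" "(\<Sum>i\<in>I. A t i * x i) = 1"
      using z tz by (auto simp: sc divide_le_0_iff)
    define \<alpha> where "\<alpha> s = (\<Sum>i\<in>I. A s i * x i)" for s
    define \<gamma> where "\<gamma> = (\<Sum>i\<in>I. c i * x i)"
    \<comment> \<open>\<open>x\<close> satisfies all constraints in \<open>S\<close> but not \<open>t\<close>; projecting along \<open>x\<close> onto the kernel of
      \<open>A t\<close> eliminates the constraint \<open>t\<close>.\<close>
    have *: "(\<Sum>i\<in>I. (b i - k * A t i) * y i) =
        (\<Sum>i\<in>I. b i * (y i - (\<Sum>i\<in>I. A t i * y i) * x i))" if "k = (\<Sum>i\<in>I. b i * x i)" for b k y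
    proof -
      have "(\<Sum>i\<in>I. (b i - k * A t i) * y i) = (\<Sum>i\<in>I. b i * y i) - k * (\<Sum>i\<in>I. A t i * y i)"
        by (simp add: algebra_simps sum_subtractf sum_distrib_left)
      moreover have "(\<Sum>i\<in>I. b i * (y i - q * x i)) = (\<Sum>i\<in>I. b i * y i) - q * (\<Sum>i\<in>I. b i * x i)" for q
        by (simp add: algebra_simps sum_subtractf sum_distrib_left)
      ultimately show ?thesis using that by simp
    qed
    obtain w where w: "\<forall>s\<in>S. 0 \<le> w s"
        "\<forall>i\<in>I. (\<Sum>s\<in>S. w s * (A s i - \<alpha> s * A t i)) = c i - \<gamma> * A t i"
    proof (atomize_elim, rule insert.IH)
      fix y assume y: "\<And>s. s \<in> S \<Longrightarrow> (\<Sum>i\<in>I. (A s i - \<alpha> s * A t i) * y i) \<le> 0"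
      let ?y = "\<lambda>i. y i - (\<Sum>i\<in>I. A t i * y i) * x i"
      have "(\<Sum>i\<in>I. A s i * ?y i) \<le> 0" if "s \<in> insert t S" for s
      proof (cases "s = t")
        case True
        have "(\<Sum>i\<in>I. A t i * ?y i) = 0"
          using *[of 1 "A t" y] x(3) by simp
        then show ?thesis using True by simp
      next
        case False
        then show ?thesis using that y[of s] *[OF \<alpha>_def, of s y] by simp
      qed
      then have "(\<Sum>i\<in>I. c i * ?y i) \<le> 0" by (rule insert.prems)
      then show "(\<Sum>i\<in>I. (c i - \<gamma> * A t i) * y i) \<le> 0" using *[OF \<gamma>_def] by simp
    qed
    \<comment> \<open>Undoing the projection collects all multiples of \<open>A t\<close> in the
      weight of \<open>t\<close>. It is nonnegative because \<open>\<gamma>\<close> is positive and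
      every \<open>\<alpha> s\<close> is nonpositive.\<close>
    define k where "k = \<gamma> - (\<Sum>s\<in>S. w s * \<alpha> s)"
    have "(\<Sum>s\<in>S. w s * \<alpha> s) \<le> 0"
      using w(1) x(1) by (intro sum_nonpos mult_nonneg_nonpos) (auto simp: \<alpha>_def)
    then have k: "k \<ge> 0" using x(2) by (simp add: k_def \<gamma>_def)
    have "k * A t i + (\<Sum>s\<in>S. w s * A s i) = c i" if "i \<in> I" for i
    proof -
      have "(\<Sum>s\<in>S. w s * A s i) - (\<Sum>s\<in>S. w s * \<alpha> s) * A t i = c i - \<gamma> * A t i"
      proof -
        have "(\<Sum>s\<in>S. w s * (A s i - \<alpha> s * A t i)) =
            (\<Sum>s\<in>S. w s * A s i) - (\<Sum>s\<in>S. w s * \<alpha> s) * A t i"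
          by (simp add: right_diff_distrib sum_subtractf sum_distrib_right mult.assoc)
        then show ?thesis using w(2) that by simp
      qed
      then show ?thesis by (simp add: k_def algebra_simps)
    qed
    moreover have "(\<Sum>s\<in>S. (w(t := k)) s * A s i) = (\<Sum>s\<in>S. w s * A s i)" for i
      using insert.hyps by (intro sum.cong) auto
    ultimately show ?thesis
      using w(1) k insert.hyps by (intro exI[of _ "w(t := k)"]) auto
  qed
qed

text \<open>Complementary slackness says where dual weights may sit: on the active constraints
  \<open>T\<close>. A direction along which no active constraint increases stays feasible for a
  short step, so by optimality it cannot raise the objective; this is the hypothesis of Farkas for
  the active rows.\<close>

lemma lp_strong_duality:
  assumes S: "finite S" and opt: "lp_opt N m g gb f S y0 y"
  obtains w where "dual_feas N m g gb S w" "(\<Sum>x\<in>S. f x * w x) = lp_obj N m gb y0 y"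
proof -
  define P where "P = Sigma {..<N} (\<lambda>i. {..<m i})"
  \<comment> \<open>\<open>None\<close> is the coordinate of \<open>y0\<close> and
    \<open>Some (i, j)\<close> that of \<open>y i j\<close>, so that normalisation and moment
    equations form one linear system.\<close>
  define I where "I = insert None (Some ` P)"
  define A where "A x k = (case k of None \<Rightarrow> 1 | Some (i, j) \<Rightarrow> g i j (x i))" for x :: "nat \<Rightarrow> 'a" and k
  define c where "c k = (case k of None \<Rightarrow> 1 | Some (i, j) \<Rightarrow> gb i j)" for k
  define T where "T = {x\<in>S. y0 + ginner N m g x y = f x}"
  have finP: "finite P" by (simp add: P_def)
  have feas: "y \<in> yspace N m" "\<And>x. x \<in> S \<Longrightarrow> y0 + ginner N m g x y \<le> f x"
    and max: "\<And>z0 z. (z0, z) \<in> lp_feas N m g f S \<Longrightarrow> lp_obj N m gb z0 z \<le> lp_obj N m gb y0 y"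
    using opt by (auto simp: lp_opt_def lp_feas_def)
  have sumI: "(\<Sum>k\<in>I. h k) = h None + (\<Sum>i<N. \<Sum>j<m i. h (Some (i, j)))" for h :: "_ \<Rightarrow> real"
    using finP by (simp add: I_def sum.reindex P_def sum.Sigma split_def)
  have "\<exists>w. (\<forall>s\<in>T. 0 \<le> w s) \<and> (\<forall>k\<in>I. (\<Sum>s\<in>T. w s * A s k) = c k)"
  proof (rule farkas_bartl)
    fix u assume u: "\<And>x. x \<in> T \<Longrightarrow> (\<Sum>k\<in>I. A x k * u k) \<le> 0"
    \<comment> \<open>Cutting off outside the index range keeps the perturbed vector in
      \<open>yspace\<close>.\<close>
    define z where "z i j = (if i < N \<and> j < m i then u (Some (i, j)) else 0)" for i j
    have Au: "(\<Sum>k\<in>I. A x k * u k) = u None + ginner N m g x z" for x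
      by (simp add: sumI A_def ginner_def z_def)
    have cu: "(\<Sum>k\<in>I. c k * u k) = lp_obj N m gb (u None) z"
      by (simp add: sumI c_def lp_obj_def z_def)
    have lin: "ginner N m g x (\<lambda>i j. y i j + e * z i j) = ginner N m g x y + e * ginner N m g x z" for x e
      by (simp add: ginner_def algebra_simps sum.distrib sum_distrib_left)
    \<comment> \<open>A constraint that increases along the direction is inactive, hence has slack
      and tolerates a small step; finiteness of \<open>S\<close> gives a common step size.\<close>
    have "\<exists>e>0. \<forall>x\<in>S. y0 + ginner N m g x y + e * (u None + ginner N m g x z) \<le> f x"
    proof -
      have "\<forall>x\<in>S. \<exists>e>0. \<forall>e'. 0 < e' \<and> e' \<le> e \<longrightarrow>
          y0 + ginner N m g x y + e' * (u None + ginner N m g x z) \<le> f x"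
      proof
        fix x assume x: "x \<in> S"
        show "\<exists>e>0. \<forall>e'. 0 < e' \<and> e' \<le> e \<longrightarrow>
          y0 + ginner N m g x y + e' * (u None + ginner N m g x z) \<le> f x"
        proof (cases "u None + ginner N m g x z \<le> 0")
          case True
          show ?thesis
          proof (intro exI[of _ 1] conjI allI impI)
            fix e' :: real assume "0 < e' \<and> e' \<le> 1"
            then have "e' * (u None + ginner N m g x z) \<le> 0"
              using True by (intro mult_nonneg_nonpos) auto
            then show "y0 + ginner N m g x y + e' * (u None + ginner N m g x z) \<le> f x"
              using feas(2)[OF x] by linarith
          qed simp
        next
          case False
          then have "x \<notin> T" using u[of x] by (auto simp: Au)
          then have lt: "y0 + ginner N m g x y < f x" using feas(2)[OF x] x by (auto simp: T_def)
          let ?q = "u None + ginner N m g x z"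
          let ?e = "(f x - (y0 + ginner N m g x y)) / ?q"
          show ?thesis
          proof (intro exI[of _ ?e] conjI allI impI)
            show "0 < ?e" using lt False by simp
            fix e' :: real assume "0 < e' \<and> e' \<le> ?e"
            then have "e' * ?q \<le> f x - (y0 + ginner N m g x y)"
              using False by (simp add: pos_le_divide_eq)
            then show "y0 + ginner N m g x y + e' * ?q \<le> f x" by linarith
          qed
        qed
      qed
      then obtain e where e: "\<And>x. x \<in> S \<Longrightarrow> e x > 0"
        "\<And>x e'. x \<in> S \<Longrightarrow> 0 < e' \<Longrightarrow> e' \<le> e x \<Longrightarrow>
          y0 + ginner N m g x y + e' * (u None + ginner N m g x z) \<le> f x"
        by metis
      \<comment> \<open>The element 1 keeps the minimum defined when \<open>S\<close> is
        empty.\<close>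
      define \<delta> where "\<delta> = Min (insert 1 (e ` S))"
      have "\<delta> > 0" using S e(1) by (auto simp: \<delta>_def)
      moreover have "\<delta> \<le> e x" if "x \<in> S" for x using S that by (auto simp: \<delta>_def)
      ultimately show ?thesis using e(2) by blast
    qed
    then obtain e where e: "e > 0"
      "\<forall>x\<in>S. y0 + ginner N m g x y + e * (u None + ginner N m g x z) \<le> f x" by blast
    have "(\<lambda>i j. y i j + e * z i j) \<in> yspace N m"
      using feas(1) by (auto simp: yspace_def z_def)
    then have "(y0 + e * u None, \<lambda>i j. y i j + e * z i j) \<in> lp_feas N m g f S"
      using e(2) by (auto simp: lp_feas_def lin algebra_simps)
    then have "lp_obj N m gb (y0 + e * u None) (\<lambda>i j. y i j + e * z i j) \<le> lp_obj N m gb y0 y"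
      by (rule max)
    moreover have "lp_obj N m gb (y0 + e * u None) (\<lambda>i j. y i j + e * z i j)
        = lp_obj N m gb y0 y + e * lp_obj N m gb (u None) z"
      by (simp add: lp_obj_def algebra_simps sum.distrib sum_distrib_left)
    ultimately have "e * lp_obj N m gb (u None) z \<le> 0" by linarith
    then show "(\<Sum>k\<in>I. c k * u k) \<le> 0" using e(1) by (simp add: cu mult_le_0_iff)
  qed (use S finP in \<open>auto simp: T_def I_def\<close>)
  then obtain w where w: "\<And>s. s \<in> T \<Longrightarrow> 0 \<le> w s" "\<And>k. k \<in> I \<Longrightarrow> (\<Sum>s\<in>T. w s * A s k) = c k"
    by blast
  define w' where "w' x = (if x \<in> T then w x else 0)" for x
  have ext: "(\<Sum>x\<in>S. h x * w' x) = (\<Sum>x\<in>T. h x * w x)" for h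
    using S by (simp add: w'_def T_def if_distrib sum.If_cases Int_def conj_commute cong: if_cong)
  have 1: "(\<Sum>x\<in>T. w x) = 1" using w(2)[of None] by (simp add: I_def A_def c_def)
  have g: "(\<Sum>x\<in>T. g i j (x i) * w x) = gb i j" if "i < N" "j < m i" for i j
    using w(2)[of "Some (i, j)"] that by (simp add: I_def P_def A_def c_def mult.commute)
  have "dual_feas N m g gb S w'"
    unfolding dual_feas_def using ext[of "\<lambda>_. 1"] ext[of "\<lambda>x. g _ _ (x _)"] 1 g w(1)
    by (auto simp: w'_def[abs_def] simp del: sum_mult_of_bool_eq)
  moreover have "(\<Sum>x\<in>S. f x * w' x) = lp_obj N m gb y0 y"
  proof -
    \<comment> \<open>On \<open>T\<close> the constraint is an equality, so the cost is affine in
      the moments, which the dual equations evaluate to the primal objective.\<close>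
    have "(\<Sum>x\<in>T. f x * w x) = (\<Sum>x\<in>T. (y0 + ginner N m g x y) * w x)"
      by (intro sum.cong) (auto simp: T_def)
    also have "\<dots> = y0 * (\<Sum>x\<in>T. w x) + (\<Sum>x\<in>T. \<Sum>i<N. \<Sum>j<m i. g i j (x i) * w x * y i j)"
      by (simp add: ginner_def algebra_simps sum.distrib sum_distrib_left)
    also have "(\<Sum>x\<in>T. \<Sum>i<N. \<Sum>j<m i. g i j (x i) * w x * y i j)
        = (\<Sum>i<N. \<Sum>x\<in>T. \<Sum>j<m i. g i j (x i) * w x * y i j)"
      by (rule sum.swap)
    also have "\<dots> = (\<Sum>i<N. \<Sum>j<m i. \<Sum>x\<in>T. g i j (x i) * w x * y i j)"
      by (intro sum.cong refl sum.swap)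
    also have "\<dots> = (\<Sum>i<N. \<Sum>j<m i. gb i j * y i j)"
      using g by (intro sum.cong refl) (simp flip: sum_distrib_right)
    finally show ?thesis by (simp add: ext 1 lp_obj_def)
  qed
  ultimately show ?thesis using that by blast
qed

corollary dual_opt_value_le:
  assumes "finite S" "lp_opt N m g gb f S y0 y" "dual_opt N m g gb f S w"
  shows "(\<Sum>x\<in>S. f x * w x) \<le> lp_obj N m gb y0 y"
  using lp_strong_duality[OF assms(1,2)] assms(3) unfolding dual_opt_def by metis

subsection \<open>Compact metric spaces with a Borel measure\<close>

text \<open>The topology belongs to the carrier \<open>X\<close>, not to the type. The measure also
  fixes the sigma-algebra: statements about further measures only ask that their \<open>sets\<close>
  agree with those of \<open>\<mu>\<close>.\<close>

locale compact_metric_measure = Metric_space X d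
  for X :: "'a set" and d and \<mu> :: "'a measure" +
  assumes compact: "compact_space mtopology"
    and space_eq: "space \<mu> = X"
    and sets_eq: "sets \<mu> = sets (borel_of mtopology)"
begin

lemma open_in_sets:
  assumes "openin mtopology U"
  shows "U \<in> sets \<mu>"
proof -
  have "{U. openin mtopology U} \<subseteq> Pow (topspace mtopology)" using openin_subset by blast
  then have "sets (borel_of mtopology) = sigma_sets (topspace mtopology) {U. openin mtopology U}"
    unfolding borel_of_def by (rule sets_measure_of)
  then show ?thesis using assms unfolding sets_eq by blast
qed

lemma continuous_map_measurable:
  fixes h :: "'a \<Rightarrow> 'b::topological_space"
  assumes "continuous_map mtopology euclidean h"
  shows "h \<in> borel_measurable \<mu>"
proof (rule borel_measurableI)
  fix U :: "'b set" assume "open U"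
  then have "openin mtopology {x \<in> topspace mtopology. h x \<in> U}"
    using assms by (intro openin_continuous_map_preimage) auto
  moreover have "{x \<in> topspace mtopology. h x \<in> U} = h -` U \<inter> space \<mu>" by (auto simp: space_eq)
  ultimately show "h -` U \<inter> space \<mu> \<in> sets \<mu>" using open_in_sets by metis
qed

lemma lipschitz_continuous_map:
  fixes h :: "'a \<Rightarrow> 'b::metric_space"
  assumes lip: "\<And>x y. x \<in> X \<Longrightarrow> y \<in> X \<Longrightarrow> dist (h x) (h y) \<le> K * d x y"
  shows "continuous_map mtopology euclidean h"
proof -
  have "Met_TC.mtopology = (euclidean :: 'b topology)" by (rule mtopology_is_euclidean)
  moreover have "continuous_map mtopology Met_TC.mtopology h"
    unfolding metric_continuous_map[OF Met_TC.Metric_space_axioms]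
  proof (intro conjI ballI allI impI)
    fix a and \<epsilon> :: real assume a: "a \<in> X" and \<epsilon>: "0 < \<epsilon>"
    \<comment> \<open>\<open>K\<close> may be zero or negative, and the radius below divides by this
      constant.\<close>
    define K' where "K' = max K 1"
    have "dist (h a) (h x) < \<epsilon>" if "x \<in> X" "d a x < \<epsilon> / K'" for x
    proof -
      have "dist (h a) (h x) \<le> K * d a x" using lip a that by blast
      also have "\<dots> \<le> K' * d a x" by (intro mult_right_mono) (auto simp: K'_def)
      also have "\<dots> < \<epsilon>" using that(2) by (simp add: K'_def field_simps pos_less_divide_eq)
      finally show ?thesis .
    qed
    then show "\<exists>\<delta>>0. \<forall>x. x \<in> X \<and> d a x < \<delta> \<longrightarrow> dist (h a) (h x) < \<epsilon>"
      using \<epsilon> by (intro exI[of _ "\<epsilon> / K'"]) (auto simp: K'_def)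
  qed auto
  ultimately show ?thesis by simp
qed

lemma dist_triangle_bound:
  assumes "q \<in> X" "x \<in> X" "y \<in> X"
  shows "dist (d q x) (d q y) \<le> d x y"
  using triangle[OF assms] triangle[OF assms(1,3,2)] commute[of x y] by (simp add: dist_real_def abs_le_iff)

lemma measurable_dist_left: "q \<in> X \<Longrightarrow> d q \<in> borel_measurable \<mu>"
  by (intro continuous_map_measurable lipschitz_continuous_map[where K=1])
     (use dist_triangle_bound in auto)

text \<open>Compactness gives total boundedness, and the finite nets of radius
  \<open>1 / Suc n\<close> unite to a countable dense set. Separability is what links the metrics
  with the product sigma-algebra.\<close>

lemma ex_countable_dense:
  "\<exists>D. countable D \<and> D \<subseteq> X \<and> (\<forall>x\<in>X. \<forall>e>0. \<exists>q\<in>D. d q x < e)"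
proof -
  have tb: "mtotally_bounded X"
    using compact by (auto simp: compact_space_def intro: compactin_imp_mtotally_bounded)
  have "\<forall>n. \<exists>K. finite K \<and> K \<subseteq> X \<and> X \<subseteq> (\<Union>x\<in>K. mball x (1 / Suc n))"
    using tb unfolding mtotally_bounded_def by simp
  then obtain K where K: "\<And>n. finite (K n)" "\<And>n. K n \<subseteq> X"
    "\<And>n. X \<subseteq> (\<Union>x\<in>K n. mball x (1 / Suc n))" by metis
  show ?thesis
  proof (intro exI[of _ "\<Union>n. K n"] conjI ballI allI impI)
    show "countable (\<Union>n. K n)" using K(1) by (simp add: countable_finite)
    fix x and e :: real assume "x \<in> X" "e > 0"
    obtain n where "1 / Suc n < e" using nat_approx_posE[OF \<open>e > 0\<close>] .
    moreover obtain q where "q \<in> K n" "d q x < 1 / Suc n" using K(3)[of n] \<open>x \<in> X\<close> by auto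
    ultimately show "\<exists>q\<in>\<Union>n. K n. d q x < e" by (meson UN_I UNIV_I less_trans)
  qed (use K(2) in blast)
qed

lemma dist_bounded: "\<exists>B. \<forall>x\<in>X. \<forall>y\<in>X. d x y \<le> B"
  using compactin_imp_mbounded[of X] compact by (simp add: compact_space_def mbounded_alt)

end

section \<open>Measurability on product spaces\<close>

text \<open>The hypotheses make \<open>F\<close> the pointwise infimum of a countable measurable
  family. In the applications each \<open>G q\<close> is a sum of functions of one
  coordinate.\<close>

lemma measurable_countable_inf:
  fixes F :: "'b \<Rightarrow> real"
  assumes K: "countable K" and G: "\<And>q. q \<in> K \<Longrightarrow> G q \<in> borel_measurable A"
    and le: "\<And>x q. x \<in> space A \<Longrightarrow> q \<in> K \<Longrightarrow> F x \<le> G q x"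
    and approx: "\<And>x e. x \<in> space A \<Longrightarrow> e > 0 \<Longrightarrow> \<exists>q\<in>K. G q x \<le> F x + e"
  shows "F \<in> borel_measurable A"
proof -
  have "(\<lambda>x. INF q\<in>K. G q x) \<in> borel_measurable A" using K G by (rule borel_measurable_cINF_real)
  moreover have "(INF q\<in>K. G q x) = F x" if x: "x \<in> space A" for x
  proof (rule antisym)
    show "F x \<le> (INF q\<in>K. G q x)"
      using approx[OF x, of 1] le[OF x] by (intro cINF_greatest) auto
    show "(INF q\<in>K. G q x) \<le> F x"
    proof (rule field_le_epsilon)
      fix e :: real assume "e > 0"
      then obtain q where "q \<in> K" "G q x \<le> F x + e" using approx[OF x] by blast
      moreover have "bdd_below ((\<lambda>q. G q x) ` K)" using le[OF x] by (intro bdd_belowI2)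
      ultimately show "(INF q\<in>K. G q x) \<le> F x + e" by (meson cINF_lower2)
    qed
  qed
  ultimately show ?thesis by (simp cong: measurable_cong)
qed

text \<open>By the triangle inequality the distance of \<open>x\<close> and \<open>y\<close> is the
  infimum of \<open>d q x + d q y\<close> over a countable dense set of \<open>q\<close>, and each
  summand sees one coordinate only.\<close>

lemma (in compact_metric_measure) measurable_dist:
  assumes "sets A = sets \<mu>" "sets B = sets \<mu>"
  shows "(\<lambda>z. d (fst z) (snd z)) \<in> borel_measurable (A \<Otimes>\<^sub>M B)"
proof -
  obtain D where D: "countable D" "D \<subseteq> X" "\<And>x e. x \<in> X \<Longrightarrow> e > 0 \<Longrightarrow> \<exists>q\<in>D. d q x < e"
    using ex_countable_dense by blast
  have sp: "space A = X" "space B = X" using assms sets_eq_imp_space_eq space_eq by metis+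
  have [measurable_cong]: "sets A = sets \<mu>" "sets B = sets \<mu>" by fact+
  show ?thesis
  proof (rule measurable_countable_inf[OF D(1)])
    fix q assume "q \<in> D"
    then have [measurable]: "d q \<in> borel_measurable \<mu>" using D measurable_dist_left by blast
    show "(\<lambda>z. d q (fst z) + d q (snd z)) \<in> borel_measurable (A \<Otimes>\<^sub>M B)" by measurable
    show "d (fst z) (snd z) \<le> d q (fst z) + d q (snd z)" if "z \<in> space (A \<Otimes>\<^sub>M B)" for z
      using that \<open>q \<in> D\<close> D(2) triangle[of "fst z" q "snd z"]
      by (auto simp: space_pair_measure sp commute[of q])
  next
    fix z and e :: real assume z: "z \<in> space (A \<Otimes>\<^sub>M B)" and "e > 0"
    \<comment> \<open>Half of \<open>e\<close>, since the distance from \<open>q\<close> to the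
      first point is paid twice.\<close>
    then obtain q where q: "q \<in> D" "d q (fst z) < e / 2"
      using D(3)[of "fst z" "e / 2"] by (auto simp: space_pair_measure sp)
    have "d q (snd z) \<le> d q (fst z) + d (fst z) (snd z)"
      using z q D(2) by (intro triangle) (auto simp: space_pair_measure sp)
    then show "\<exists>q\<in>D. d q (fst z) + d q (snd z) \<le> d (fst z) (snd z) + e"
      using q by (intro bexI[of _ q]) auto
  qed
qed

text \<open>McShane's formula: a Lipschitz function is the infimum of the cones
  \<open>f q + L * (\<Sum>i<N. d i (q i) (x i))\<close>, where it suffices that \<open>q\<close>
  ranges over a countable dense subset of the product.\<close>

lemma lipschitz_measurable_PiM:
  fixes N :: nat
  assumes cm: "\<And>i. i < N \<Longrightarrow> compact_metric_measure (X i) (d i) (M i)"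
    and lip: "\<And>x y. x \<in> PiE {..<N} X \<Longrightarrow> y \<in> PiE {..<N} X \<Longrightarrow> \<bar>f x - f y\<bar> \<le> L * (\<Sum>i<N. d i (x i) (y i))"
    and L: "L > 0"
  shows "f \<in> borel_measurable (PiM {..<N} M)"
proof -
  have "\<forall>i\<in>{..<N}. \<exists>D. countable D \<and> D \<subseteq> X i \<and> (\<forall>x\<in>X i. \<forall>e>0. \<exists>q\<in>D. d i q x < e)"
    using compact_metric_measure.ex_countable_dense[OF cm] by blast
  then obtain D where D: "\<And>i. i < N \<Longrightarrow> countable (D i)" "\<And>i. i < N \<Longrightarrow> D i \<subseteq> X i"
    "\<And>i x e. i < N \<Longrightarrow> x \<in> X i \<Longrightarrow> e > 0 \<Longrightarrow> \<exists>q\<in>D i. d i q x < e"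
    unfolding bchoice_iff by (metis lessThan_iff)
  have sp: "space (PiM {..<N} M) = PiE {..<N} X"
    unfolding space_PiM by (intro PiE_cong) (simp add: compact_metric_measure.space_eq[OF cm])
  show ?thesis
  proof (rule measurable_countable_inf)
    show "countable (PiE {..<N} D)" using D(1) by (intro countable_PiE) auto
    have DX: "PiE {..<N} D \<subseteq> PiE {..<N} X" using D(2) by (intro PiE_mono) auto
    fix q assume q: "q \<in> PiE {..<N} D"
    have "(\<lambda>x. d i (q i) (x i)) \<in> borel_measurable (PiM {..<N} M)" if "i < N" for i
    proof (rule measurable_compose[OF measurable_component_singleton])
      show "d i (q i) \<in> borel_measurable (M i)"
        using q that D(2) by (intro compact_metric_measure.measurable_dist_left[OF cm]) auto
    qed (use that in auto)
    then show "(\<lambda>x. f q + L * (\<Sum>i<N. d i (q i) (x i))) \<in> borel_measurable (PiM {..<N} M)"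
      by (intro borel_measurable_add borel_measurable_times borel_measurable_sum) auto
    show "f x \<le> f q + L * (\<Sum>i<N. d i (q i) (x i))" if "x \<in> space (PiM {..<N} M)" for x
      using lip[of q x] that q DX by (auto simp: sp)
  next
    fix x and e :: real assume x: "x \<in> space (PiM {..<N} M)" and e: "e > 0"
    \<comment> \<open>The weighted distance from \<open>q\<close> to \<open>x\<close> is paid twice,
      in \<open>f q\<close> and in the cone, so it should be at most \<open>e / 2\<close>;
      \<open>real N + 1\<close> keeps the denominator positive also for
      \<open>N = 0\<close>.\<close>
    define \<delta> where "\<delta> = e / (2 * L * (real N + 1))"
    have \<delta>: "\<delta> > 0" using e L by (simp add: \<delta>_def)
    have "\<forall>i\<in>{..<N}. \<exists>q\<in>D i. d i q (x i) < \<delta>" using D(3) x \<delta> by (auto simp: sp PiE_def Pi_def)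
    then obtain q0 where q0: "\<And>i. i < N \<Longrightarrow> q0 i \<in> D i \<and> d i (q0 i) (x i) < \<delta>"
      unfolding bchoice_iff Bex_def by (metis lessThan_iff)
    define q where "q = restrict q0 {..<N}"
    have q: "q \<in> PiE {..<N} D" "q \<in> PiE {..<N} X" using q0 D(2) by (auto simp: q_def)
    have "(\<Sum>i<N. d i (q i) (x i)) \<le> (\<Sum>i<N. \<delta>)"
      using q0 by (intro sum_mono) (auto simp: q_def intro: less_imp_le)
    then have s: "L * (\<Sum>i<N. d i (q i) (x i)) \<le> L * (real N * \<delta>)" using L by simp
    have "L * (real N * \<delta>) \<le> L * ((real N + 1) * \<delta>)" using L \<delta> by simp
    also have "\<dots> = e / 2" using L by (simp add: \<delta>_def add_nonneg_eq_0_iff)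
    finally have s2: "L * (\<Sum>i<N. d i (q i) (x i)) \<le> e / 2" using s by simp
    have "f q \<le> f x + L * (\<Sum>i<N. d i (q i) (x i))" using lip[OF q(2), of x] x by (simp add: sp)
    then show "\<exists>q\<in>PiE {..<N} D. f q + L * (\<Sum>i<N. d i (q i) (x i)) \<le> f x + e"
      using s2 q(1) by (intro bexI[of _ q]) auto
  qed
qed

lemma lipschitz_bounded_PiE:
  fixes N :: nat
  assumes cm: "\<And>i. i < N \<Longrightarrow> compact_metric_measure (X i) (d i) (M i)"
    and lip: "\<And>x y. x \<in> PiE {..<N} X \<Longrightarrow> y \<in> PiE {..<N} X \<Longrightarrow> \<bar>f x - f y\<bar> \<le> L * (\<Sum>i<N. d i (x i) (y i))"
    and L: "L > 0"
  shows "\<exists>B. \<forall>x\<in>PiE {..<N} X. \<bar>f x\<bar> \<le> B"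
proof (cases "PiE {..<N} X = {}")
  case False
  then obtain q where q: "q \<in> PiE {..<N} X" by blast
  have "\<forall>i\<in>{..<N}. \<exists>B. \<forall>x\<in>X i. \<forall>y\<in>X i. d i x y \<le> B"
    using compact_metric_measure.dist_bounded[OF cm] by blast
  then obtain B where B: "\<And>i x y. i < N \<Longrightarrow> x \<in> X i \<Longrightarrow> y \<in> X i \<Longrightarrow> d i x y \<le> B i"
    unfolding bchoice_iff by (metis lessThan_iff)
  have "\<bar>f x\<bar> \<le> \<bar>f q\<bar> + L * (\<Sum>i<N. B i)" if x: "x \<in> PiE {..<N} X" for x
  proof -
    have "(\<Sum>i<N. d i (x i) (q i)) \<le> (\<Sum>i<N. B i)"
      using x q by (intro sum_mono B) auto
    then have "\<bar>f x - f q\<bar> \<le> L * (\<Sum>i<N. B i)"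
      using lip[OF x q] L by (meson mult_le_cancel_left_pos order_trans)
    then show ?thesis by linarith
  qed
  then show ?thesis by blast
qed simp

section \<open>Wasserstein distance and the radius of a moment set\<close>

text \<open>Reassembly has the discrete marginal as first argument of \<open>W1\<close>, whereas
  \<open>Wbar\<close> has the prescribed one; swapping the coordinates of a coupling mediates.
  Nonemptiness keeps the infimum on the right meaningful.\<close>

lemma (in compact_metric_measure) W1_commute_le:
  assumes "sets \<nu> = sets \<mu>" "sets \<nu>' = sets \<mu>" "couplings2 \<nu> \<nu>' \<noteq> {}"
  shows "W1 d \<nu>' \<nu> \<le> W1 d \<nu> \<nu>'"
  unfolding W1_def
proof (rule cINF_greatest[OF assms(3)])
  fix \<pi> assume "\<pi> \<in> couplings2 \<nu> \<nu>'"
  then have p: "sets \<pi> = sets (\<nu> \<Otimes>\<^sub>M \<nu>')" "prob_space \<pi>" "distr \<pi> \<nu> fst = \<nu>" "distr \<pi> \<nu>' snd = \<nu>'"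
    by (auto simp: couplings2_def)
  note [measurable_cong] = p(1)
  define \<pi>' where "\<pi>' = distr \<pi> (\<nu>' \<Otimes>\<^sub>M \<nu>) (\<lambda>z. (snd z, fst z))"
  have m: "(\<lambda>z. (snd z, fst z)) \<in> measurable \<pi> (\<nu>' \<Otimes>\<^sub>M \<nu>)" by measurable
  have "\<pi>' \<in> couplings2 \<nu>' \<nu>"
    using p m by (auto simp: couplings2_def \<pi>'_def prob_space.prob_space_distr distr_distr comp_def)
  moreover have "(\<integral>z. d (fst z) (snd z) \<partial>\<pi>') = (\<integral>z. d (fst z) (snd z) \<partial>\<pi>)"
    unfolding \<pi>'_def by (subst integral_distr[OF m]) (auto simp: commute intro!: measurable_dist assms)
  moreover have "bdd_below ((\<lambda>\<pi>. \<integral>z. d (fst z) (snd z) \<partial>\<pi>) ` couplings2 \<nu>' \<nu>)"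
    by (intro bdd_belowI2[of _ 0] integral_nonneg_AE AE_I2) simp
  ultimately show "(INF \<pi>\<in>couplings2 \<nu>' \<nu>. \<integral>z. d (fst z) (snd z) \<partial>\<pi>) \<le> (\<integral>z. d (fst z) (snd z) \<partial>\<pi>)"
    by (metis (mono_tags, lifting) cINF_lower)
qed

lemma product_in_couplings2:
  assumes "prob_space \<mu>" "prob_space \<nu>"
  shows "\<mu> \<Otimes>\<^sub>M \<nu> \<in> couplings2 \<mu> \<nu>"
proof -
  interpret a: prob_space \<mu> by fact
  interpret b: prob_space \<nu> by fact
  interpret p: pair_prob_space \<mu> \<nu> ..
  have 1: "distr (\<mu> \<Otimes>\<^sub>M \<nu>) \<mu> fst = \<mu>" by (rule b.distr_pair_fst)
  have "distr (\<mu> \<Otimes>\<^sub>M \<nu>) \<nu> snd = distr (distr (\<nu> \<Otimes>\<^sub>M \<mu>) (\<mu> \<Otimes>\<^sub>M \<nu>) (\<lambda>(x, y). (y, x))) \<nu> snd"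
    using p.distr_pair_swap by simp
  also have "\<dots> = distr (\<nu> \<Otimes>\<^sub>M \<mu>) \<nu> fst"
    by (subst distr_distr) (auto simp: comp_def split_def)
  also have "\<dots> = \<nu>" by (rule a.distr_pair_fst)
  finally show ?thesis using 1 p.prob_space_axioms by (simp add: couplings2_def)
qed

lemma (in compact_metric_measure) W1_le:
  assumes "sets \<nu> = sets \<mu>" "sets \<nu>' = sets \<mu>" "\<pi> \<in> couplings2 \<nu> \<nu>'"
    and "AE z in \<pi>. d (fst z) (snd z) \<le> B"
  shows "W1 d \<nu> \<nu>' \<le> B"
proof -
  from assms(3) have s: "sets \<pi> = sets (\<nu> \<Otimes>\<^sub>M \<nu>')" and "prob_space \<pi>" by (auto simp: couplings2_def)
  interpret prob_space \<pi> by fact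
  have m: "(\<lambda>z. d (fst z) (snd z)) \<in> borel_measurable \<pi>"
    using measurable_dist[OF assms(1,2)] by (simp cong: measurable_cong_sets add: s)
  have "bdd_below ((\<lambda>\<pi>. \<integral>z. d (fst z) (snd z) \<partial>\<pi>) ` couplings2 \<nu> \<nu>')"
    by (intro bdd_belowI2[of _ 0] integral_nonneg_AE AE_I2) simp
  then have "W1 d \<nu> \<nu>' \<le> (\<integral>z. d (fst z) (snd z) \<partial>\<pi>)"
    unfolding W1_def using assms(3) by (rule cINF_lower)
  also have "\<dots> \<le> B"
    using assms(4) by (intro integral_le_const integrable_const_bound[of _ B]) (auto simp: m)
  finally show ?thesis .
qed

text \<open>A real supremum dominates its family only if the family is bounded above; the diameter
  of \<open>X\<close>, tested on product couplings, gives that bound. The arguments of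
  \<open>W1\<close> are in the order in which reassembly uses them.\<close>

lemma (in compact_metric_measure) W1_le_Wbar:
  assumes "prob_space \<mu>" "\<nu> \<in> moment_set \<mu> g m"
  shows "W1 d \<nu> \<mu> \<le> Wbar d \<mu> g m"
proof -
  obtain B where B: "\<And>x y. x \<in> X \<Longrightarrow> y \<in> X \<Longrightarrow> d x y \<le> B" using dist_bounded by blast
  have "W1 d \<mu> \<nu> \<le> B" if "\<nu> \<in> moment_set \<mu> g m" for \<nu>
  proof (rule W1_le)
    from that have \<nu>: "prob_space \<nu>" "sets \<nu> = sets \<mu>" by (auto simp: moment_set_def)
    then show "\<mu> \<Otimes>\<^sub>M \<nu> \<in> couplings2 \<mu> \<nu>" using assms by (intro product_in_couplings2)
    have "space \<nu> = X" using \<nu>(2) sets_eq_imp_space_eq space_eq by metis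
    then show "AE z in \<mu> \<Otimes>\<^sub>M \<nu>. d (fst z) (snd z) \<le> B"
      by (intro AE_I2 B) (auto simp: space_pair_measure space_eq)
  qed (use that in \<open>auto simp: moment_set_def\<close>)
  then have "bdd_above (W1 d \<mu> ` moment_set \<mu> g m)" by (rule bdd_aboveI2)
  then have "W1 d \<mu> \<nu> \<le> Wbar d \<mu> g m" unfolding Wbar_def using assms(2) by (intro cSUP_upper)
  moreover have "W1 d \<nu> \<mu> \<le> W1 d \<mu> \<nu>"
    using assms product_in_couplings2[OF assms(1), of \<nu>]
    by (intro W1_commute_le) (auto simp: moment_set_def)
  ultimately show ?thesis by simp
qed

section \<open>Finitely supported measures\<close>

text \<open>\<open>measure_of\<close> yields the intended measure only if the given set function is
  countably additive. Recognising it as the image of a point measure under inclusion settles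
  this.\<close>

lemma discrete_meas_eq_distr:
  assumes "finite S" "S \<subseteq> space \<Omega>"
  shows "discrete_meas \<Omega> S w = distr (point_measure S (\<lambda>x. ennreal (w x))) \<Omega> (\<lambda>x. x)"
  unfolding discrete_meas_def distr_def
proof (rule measure_of_eq)
  fix A assume "A \<in> sigma_sets (space \<Omega>) (sets \<Omega>)"
  have "emeasure (point_measure S (\<lambda>x. ennreal (w x))) (A \<inter> S) = (\<Sum>x\<in>A \<inter> S. ennreal (w x))"
    using assms by (intro emeasure_point_measure_finite2) auto
  also have "\<dots> = (\<Sum>x\<in>S. ennreal (w x) * indicator A x)"
    using assms(1) by (auto simp: indicator_def sum.If_cases Int_commute if_distrib cong: if_cong)
  finally show "(\<Sum>x\<in>S. ennreal (w x) * indicator A x) =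
    emeasure (point_measure S (\<lambda>x. ennreal (w x))) ((\<lambda>x. x) -` A \<inter> space (point_measure S (\<lambda>x. ennreal (w x))))"
    by (simp add: space_point_measure)
qed (rule sets.space_closed)

lemma
  fixes h :: "'b \<Rightarrow> real"
  assumes "finite S" "S \<subseteq> space \<Omega>" "\<And>x. x \<in> S \<Longrightarrow> w x \<ge> 0"
  shows integral_discrete_meas:
      "h \<in> borel_measurable \<Omega> \<Longrightarrow> (\<integral>x. h x \<partial>discrete_meas \<Omega> S w) = (\<Sum>x\<in>S. h x * w x)"
    and prob_space_discrete_meas: "(\<Sum>x\<in>S. w x) = 1 \<Longrightarrow> prob_space (discrete_meas \<Omega> S w)"
    and sets_discrete_meas: "sets (discrete_meas \<Omega> S w) = sets \<Omega>"
proof -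
  let ?P = "point_measure S (\<lambda>x. ennreal (w x))"
  have m: "(\<lambda>x. x) \<in> measurable ?P \<Omega>" using assms(2) by (auto simp: measurable_point_measure_eq1)
  show "(\<integral>x. h x \<partial>discrete_meas \<Omega> S w) = (\<Sum>x\<in>S. h x * w x)" if "h \<in> borel_measurable \<Omega>"
    using that assms
    by (simp add: discrete_meas_eq_distr integral_distr[OF m] lebesgue_integral_point_measure_finite mult.commute)
  show "prob_space (discrete_meas \<Omega> S w)" if "(\<Sum>x\<in>S. w x) = 1"
  proof -
    have "prob_space ?P"
      using that assms by (intro prob_spaceI)
        (simp add: space_point_measure emeasure_point_measure_finite sum_ennreal)
    then show ?thesis
      using prob_space.prob_space_distr[OF _ m] assms by (simp add: discrete_meas_eq_distr)
  qed
  show "sets (discrete_meas \<Omega> S w) = sets \<Omega>"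
    using assms by (simp add: discrete_meas_eq_distr)
qed

subsection \<open>The error bound for Algorithm 2\<close>

lemma coupling_component_integral:
  fixes h :: "'a \<Rightarrow> real"
  assumes "\<pi> \<in> couplings N M" "i < N" "integrable (M i) h"
  shows "integrable \<pi> (\<lambda>x. h (x i))" "(\<integral>x. h (x i) \<partial>\<pi>) = (\<integral>x. h x \<partial>M i)"
proof -
  have s: "sets \<pi> = sets (PiM {..<N} M)" and e: "distr \<pi> (M i) (\<lambda>x. x i) = M i"
    using assms by (auto simp: couplings_def)
  have m: "(\<lambda>x. x i) \<in> measurable \<pi> (M i)"
    using assms(2) measurable_component_singleton[of i "{..<N}" M]
    by (simp cong: measurable_cong_sets add: s)
  show "integrable \<pi> (\<lambda>x. h (x i))"
    by (rule integrable_distr[OF m]) (simp add: e assms(3))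
  show "(\<integral>x. h (x i) \<partial>\<pi>) = (\<integral>x. h x \<partial>M i)"
    using integral_distr[OF m, of h] assms(3) by (simp add: e borel_measurable_integrable)
qed

text \<open>The terminating round certifies the bounds; induction over the rounds shows that its
  constraint set is finite and inside \<open>Xp\<close>.\<close>

lemma alg1_output_optimal:
  assumes out: "alg1_output Xp N m g gb f Or epsL X0 aUBr aLBr hy0 hy S w"
    and X0: "finite X0" "X0 \<subseteq> Xp"
  obtains y0 where "finite S" "S \<subseteq> Xp" "lp_opt N m g gb f S y0 hy" "dual_opt N m g gb f S w"
    "y0 - snd (Or hy) \<le> epsL" "aLBr = lp_obj N m gb y0 hy - y0 + snd (Or hy)"
proof -
  obtain Xs y0s ys ws Xst R where run: "Xs 0 = X0"
       "\<And>r. r \<le> R \<Longrightarrow> lp_opt N m g gb f (Xs r) (y0s r) (ys r) \<and> dual_opt N m g gb f (Xs r) (ws r)"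
       "\<And>r. r < R \<Longrightarrow> finite (Xst r) \<and> Xst r \<subseteq> Xp \<and> Xs (Suc r) = Xs r \<union> Xst r"
       "y0s R - snd (Or (ys R)) \<le> epsL"
       "aLBr = lp_obj N m gb (y0s R) (ys R) - y0s R + snd (Or (ys R))"
       "hy = ys R" "S = Xs R" "w = ws R"
    using out unfolding alg1_output_def by blast
  have "r \<le> R \<Longrightarrow> finite (Xs r) \<and> Xs r \<subseteq> Xp" for r
    using X0 run(1,3) by (induction r) auto
  then show ?thesis using run that[of "y0s R"] by blast
qed

context
  fixes N :: nat and X :: "nat \<Rightarrow> 'a set" and d and M and m :: "nat \<Rightarrow> nat"
    and g :: "nat \<Rightarrow> nat \<Rightarrow> 'a \<Rightarrow> real" and L :: real and f
  assumes cm: "\<And>i. i < N \<Longrightarrow> compact_metric_measure (X i) (d i) (M i)"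
    and ps: "\<And>i. i < N \<Longrightarrow> prob_space (M i)"
    and L: "L > 0"
    and lip: "\<And>x y. x \<in> PiE {..<N} X \<Longrightarrow> y \<in> PiE {..<N} X \<Longrightarrow> \<bar>f x - f y\<bar> \<le> L * (\<Sum>i<N. d i (x i) (y i))"
    and gint: "\<And>i j. i < N \<Longrightarrow> j < m i \<Longrightarrow> integrable (M i) (g i j)"
begin

lemma space_PiM_eq: "space (PiM {..<N} M) = PiE {..<N} X"
  unfolding space_PiM by (intro PiE_cong) (simp add: compact_metric_measure.space_eq[OF cm])

lemma cost_integrable:
  assumes "prob_space \<pi>" "h \<in> measurable \<pi> (PiM {..<N} M)"
  shows "integrable \<pi> (\<lambda>x. f (h x))"
proof -
  interpret prob_space \<pi> by fact
  obtain B where B: "\<And>x. x \<in> PiE {..<N} X \<Longrightarrow> \<bar>f x\<bar> \<le> B"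
    using lipschitz_bounded_PiE[OF cm lip L] by blast
  have "(\<lambda>x. f (h x)) \<in> borel_measurable \<pi>"
    using assms(2) lipschitz_measurable_PiM[OF cm lip L] by (rule measurable_compose)
  moreover have "AE x in \<pi>. norm (f (h x)) \<le> B"
    using measurable_space[OF assms(2)] by (intro AE_I2) (simp add: B space_PiM_eq)
  ultimately show ?thesis by (intro integrable_const_bound)
qed

text \<open>Weak duality: \<open>ginner\<close> is a sum of functions of single coordinates, so its
  integral is the same for every coupling.\<close>

lemma coupling_cost_lower_bound:
  assumes "\<pi> \<in> couplings N M"
    and le: "\<And>x. x \<in> PiE {..<N} X \<Longrightarrow> s \<le> f x - ginner N m g x y"
  shows "s + (\<Sum>i<N. \<Sum>j<m i. gbar M g i j * y i j) \<le> (\<integral>x. f x \<partial>\<pi>)"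
proof -
  have \<pi>: "prob_space \<pi>" "sets \<pi> = sets (PiM {..<N} M)" using assms(1) by (auto simp: couplings_def)
  interpret prob_space \<pi> by fact
  have gi: "integrable \<pi> (\<lambda>x. g i j (x i))" "(\<integral>x. g i j (x i) \<partial>\<pi>) = gbar M g i j"
    if "i < N" "j < m i" for i j
    using coupling_component_integral[OF assms(1) that(1) gint[OF that]] by (auto simp: gbar_def)
  have fi: "integrable \<pi> f"
    using cost_integrable[of \<pi> "\<lambda>x. x"] \<pi> by (simp add: measurable_ident_sets)
  have gi': "integrable \<pi> (\<lambda>x. \<Sum>j<m i. g i j (x i) * y i j)"
      "(\<integral>x. (\<Sum>j<m i. g i j (x i) * y i j) \<partial>\<pi>) = (\<Sum>j<m i. gbar M g i j * y i j)" if "i < N" for i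
  proof -
    have int: "integrable \<pi> (\<lambda>x. g i j (x i) * y i j)" if "j < m i" for j
      using gi(1)[OF \<open>i < N\<close> that] by (rule integrable_mult_left)
    then show "integrable \<pi> (\<lambda>x. \<Sum>j<m i. g i j (x i) * y i j)"
      by (intro Bochner_Integration.integrable_sum) simp
    have "(\<integral>x. (\<Sum>j<m i. g i j (x i) * y i j) \<partial>\<pi>) = (\<Sum>j<m i. \<integral>x. g i j (x i) * y i j \<partial>\<pi>)"
      using int by (intro Bochner_Integration.integral_sum) simp
    then show "(\<integral>x. (\<Sum>j<m i. g i j (x i) * y i j) \<partial>\<pi>) = (\<Sum>j<m i. gbar M g i j * y i j)"
      using gi[OF that] by simp
  qed
  have ii: "integrable \<pi> (\<lambda>x. ginner N m g x y)"
    unfolding ginner_def by (intro Bochner_Integration.integrable_sum gi'(1)) simp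
  have "(\<integral>x. ginner N m g x y \<partial>\<pi>) = (\<Sum>i<N. \<integral>x. (\<Sum>j<m i. g i j (x i) * y i j) \<partial>\<pi>)"
    unfolding ginner_def by (intro Bochner_Integration.integral_sum gi'(1)) simp
  also have "\<dots> = (\<Sum>i<N. \<Sum>j<m i. gbar M g i j * y i j)"
    by (intro sum.cong refl gi'(2)) simp
  finally have "(\<integral>x. ginner N m g x y \<partial>\<pi>) = (\<Sum>i<N. \<Sum>j<m i. gbar M g i j * y i j)" .
  moreover have "s \<le> (\<integral>x. f x - ginner N m g x y \<partial>\<pi>)"
  proof (rule integral_ge_const)
    show "AE x in \<pi>. s \<le> f x - ginner N m g x y"
      using le sets_eq_imp_space_eq[OF \<pi>(2)] by (intro AE_I2) (simp add: space_PiM_eq)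
  qed (use fi ii in auto)
  ultimately show ?thesis using fi ii by simp
qed

lemma reassembly_cost_le:
  assumes \<mu>h: "prob_space \<mu>h" "sets \<mu>h = sets (PiM {..<N} M)"
    and mut: "mut \<in> reassembly N d M \<mu>h"
  shows "(\<integral>x. f x \<partial>mut) \<le> (\<integral>x. f x \<partial>\<mu>h) + L * (\<Sum>i<N. W1 (d i) (distr \<mu>h (M i) (\<lambda>x. x i)) (M i))"
proof -
  let ?P = "PiM {..<N} M"
  obtain \<gamma> where \<gamma>: "sets \<gamma> = sets (?P \<Otimes>\<^sub>M ?P)" "prob_space \<gamma>"
    "distr \<gamma> ?P fst = \<mu>h" "distr \<gamma> ?P snd = mut"
    and W: "\<forall>i<N. distr \<gamma> (M i \<Otimes>\<^sub>M M i) (\<lambda>z. (fst z i, snd z i))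
                \<in> couplings2 (distr \<mu>h (M i) (\<lambda>x. x i)) (M i) \<and>
             (\<integral>z. d i (fst z) (snd z) \<partial>(distr \<gamma> (M i \<Otimes>\<^sub>M M i) (\<lambda>z. (fst z i, snd z i))))
               = W1 (d i) (distr \<mu>h (M i) (\<lambda>x. x i)) (M i)"
    using mut unfolding reassembly_def mem_Collect_eq by (elim conjE exE) (rule that; assumption)
  interpret prob_space \<gamma> by fact
  note [measurable_cong] = \<gamma>(1)
  have fst_m: "fst \<in> measurable \<gamma> ?P" and snd_m: "snd \<in> measurable \<gamma> ?P" by measurable
  have f_m: "f \<in> borel_measurable ?P" by (rule lipschitz_measurable_PiM[OF cm lip L])
  have sp: "space \<gamma> = PiE {..<N} X \<times> PiE {..<N} X"
    using sets_eq_imp_space_eq[OF \<gamma>(1)] by (simp add: space_pair_measure space_PiM_eq)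
  have di: "integrable \<gamma> (\<lambda>z. d i (fst z i) (snd z i))"
    and dW: "(\<integral>z. d i (fst z i) (snd z i) \<partial>\<gamma>) = W1 (d i) (distr \<mu>h (M i) (\<lambda>x. x i)) (M i)"
    if i: "i < N" for i
  proof -
    interpret c: compact_metric_measure "X i" "d i" "M i" by (rule cm[OF i])
    have m: "(\<lambda>z. (fst z i, snd z i)) \<in> measurable \<gamma> (M i \<Otimes>\<^sub>M M i)"
    proof (rule measurable_Pair)
      show "(\<lambda>z. fst z i) \<in> measurable \<gamma> (M i)"
        by (rule measurable_compose[OF fst_m measurable_component_singleton]) (use i in simp)
      show "(\<lambda>z. snd z i) \<in> measurable \<gamma> (M i)"
        by (rule measurable_compose[OF snd_m measurable_component_singleton]) (use i in simp)
    qed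
    have dm: "(\<lambda>z. d i (fst z) (snd z)) \<in> borel_measurable (M i \<Otimes>\<^sub>M M i)"
      by (rule c.measurable_dist[OF refl refl])
    show "(\<integral>z. d i (fst z i) (snd z i) \<partial>\<gamma>) = W1 (d i) (distr \<mu>h (M i) (\<lambda>x. x i)) (M i)"
      using W i integral_distr[OF m dm] by simp
    obtain B where B: "\<And>x y. x \<in> X i \<Longrightarrow> y \<in> X i \<Longrightarrow> d i x y \<le> B" using c.dist_bounded by blast
    have mX: "fst z i \<in> X i \<and> snd z i \<in> X i" if "z \<in> space \<gamma>" for z
    proof -
      have "fst z \<in> PiE {..<N} X" "snd z \<in> PiE {..<N} X" using that unfolding sp by (simp_all add: mem_Times_iff)
      then show ?thesis using i by (simp add: PiE_mem)
    qed
    have bd: "AE z in \<gamma>. norm (d i (fst z i) (snd z i)) \<le> B"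
    proof (rule AE_I2)
      fix z assume "z \<in> space \<gamma>"
      then have "d i (fst z i) (snd z i) \<le> B" using mX B by blast
      then show "norm (d i (fst z i) (snd z i)) \<le> B" using c.nonneg by simp
    qed
    have "(\<lambda>z. d i (fst z i) (snd z i)) \<in> borel_measurable \<gamma>"
      using measurable_compose[OF m dm] by simp
    with bd show "integrable \<gamma> (\<lambda>z. d i (fst z i) (snd z i))"
      by (rule integrable_const_bound)
  qed
  \<comment> \<open>Both costs are pulled back to \<open>\<gamma>\<close>, whose coordinate pairs
    realise the optimal couplings of all marginals simultaneously.\<close>
  have "(\<integral>x. f x \<partial>mut) - (\<integral>x. f x \<partial>\<mu>h) = (\<integral>z. f (snd z) - f (fst z) \<partial>\<gamma>)"
    using integral_distr[OF fst_m f_m] integral_distr[OF snd_m f_m]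
      Bochner_Integration.integral_diff[OF cost_integrable[OF \<gamma>(2) snd_m] cost_integrable[OF \<gamma>(2) fst_m]]
    unfolding \<gamma>(3,4) by linarith
  also have "\<dots> \<le> (\<integral>z. L * (\<Sum>i<N. d i (fst z i) (snd z i)) \<partial>\<gamma>)"
  proof (rule integral_mono)
    show "f (snd z) - f (fst z) \<le> L * (\<Sum>i<N. d i (fst z i) (snd z i))" if "z \<in> space \<gamma>" for z
      using lip[of "fst z" "snd z"] that unfolding sp mem_Times_iff by linarith
  next
    show "integrable \<gamma> (\<lambda>z. f (snd z) - f (fst z))"
      using cost_integrable[OF \<gamma>(2)] fst_m snd_m by (intro Bochner_Integration.integrable_diff)
    show "integrable \<gamma> (\<lambda>z. L * (\<Sum>i<N. d i (fst z i) (snd z i)))"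
      by (intro integrable_mult_right Bochner_Integration.integrable_sum di) simp
  qed
  also have "\<dots> = L * (\<Sum>i<N. W1 (d i) (distr \<mu>h (M i) (\<lambda>x. x i)) (M i))"
  proof -
    have "(\<integral>z. (\<Sum>i<N. d i (fst z i) (snd z i)) \<partial>\<gamma>) = (\<Sum>i<N. \<integral>z. d i (fst z i) (snd z i) \<partial>\<gamma>)"
      by (intro Bochner_Integration.integral_sum di) simp
    also have "\<dots> = (\<Sum>i<N. W1 (d i) (distr \<mu>h (M i) (\<lambda>x. x i)) (M i))"
      by (intro sum.cong refl dW) simp
    finally show ?thesis by simp
  qed
  finally show ?thesis by simp
qed

lemma alg2_output_bounds:
  assumes Or: "is_oracle (PiE {..<N} X) N m g f Or"
    and out: "alg2_output N X d M m g f Or epsL aUB aLB mut epsSub"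
  shows "mut \<in> couplings N M" "(\<integral>x. f x \<partial>mut) = aUB" "epsSub = aUB - aLB"
    "\<And>\<pi>. \<pi> \<in> couplings N M \<Longrightarrow> aLB \<le> (\<integral>x. f x \<partial>\<pi>)"
    "epsSub \<le> epsL + L * (\<Sum>i<N. Wbar (d i) (M i) (g i) (m i))"
proof -
  let ?P = "PiM {..<N} M"
  obtain X0 aUBr aLBr hy0 hy S w where X0: "finite X0" "X0 \<subseteq> PiE {..<N} X"
    and alg1: "alg1_output (PiE {..<N} X) N m g (gbar M g) f Or epsL X0 aUBr aLBr hy0 hy S w"
    and mut: "mut \<in> reassembly N d M (discrete_meas ?P S w)"
    and eq: "aLB = aLBr" "aUB = (\<integral>x. f x \<partial>mut)" "epsSub = aUB - aLB"
    using out unfolding alg2_output_def by (elim exE conjE) (rule that; assumption)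
  obtain y0 where S: "finite S" "S \<subseteq> PiE {..<N} X"
    and opt: "lp_opt N m g (gbar M g) f S y0 hy" "dual_opt N m g (gbar M g) f S w"
    and gap: "y0 - snd (Or hy) \<le> epsL"
    and aLBr: "aLBr = lp_obj N m (gbar M g) y0 hy - y0 + snd (Or hy)"
    using alg1_output_optimal[OF alg1 X0] .
  show "mut \<in> couplings N M" using mut by (auto simp: reassembly_def)
  show "(\<integral>x. f x \<partial>mut) = aUB" "epsSub = aUB - aLB" using eq by auto
  have "hy \<in> yspace N m" using opt(1) by (simp add: lp_opt_def lp_feas_def)
  then have le: "snd (Or hy) \<le> f x - ginner N m g x hy" if "x \<in> PiE {..<N} X" for x
    using Or that unfolding is_oracle_def by blast
  \<comment> \<open>\<open>y0\<close> cancels in \<open>aLBr\<close>, which leaves the oracle value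
    plus the moment term of \<open>hy\<close>, the left side of weak duality.\<close>
  show "aLB \<le> (\<integral>x. f x \<partial>\<pi>)" if "\<pi> \<in> couplings N M" for \<pi>
    using coupling_cost_lower_bound[OF that le] by (simp add: eq aLBr lp_obj_def)
  define \<mu>h where "\<mu>h = discrete_meas ?P S w"
  have "dual_feas N m g (gbar M g) S w" using opt(2) by (simp add: dual_opt_def)
  then have w: "\<And>x. x \<in> S \<Longrightarrow> w x \<ge> 0" "(\<Sum>x\<in>S. w x) = 1"
    and wg: "\<And>i j. i < N \<Longrightarrow> j < m i \<Longrightarrow> (\<Sum>x\<in>S. g i j (x i) * w x) = gbar M g i j"
    by (simp_all add: dual_feas_def)
  have SP: "S \<subseteq> space ?P" using S(2) by (simp add: space_PiM_eq)
  have \<mu>h: "prob_space \<mu>h" "sets \<mu>h = sets ?P"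
    using prob_space_discrete_meas[OF S(1) SP w] sets_discrete_meas[OF S(1) SP, of w] w(1)
    by (auto simp: \<mu>h_def)
  have "(\<integral>x. f x \<partial>\<mu>h) = (\<Sum>x\<in>S. f x * w x)"
    unfolding \<mu>h_def
    by (rule integral_discrete_meas[OF S(1) SP w(1) lipschitz_measurable_PiM[OF cm lip L]])
  also have "\<dots> \<le> lp_obj N m (gbar M g) y0 hy" by (rule dual_opt_value_le[OF S(1) opt])
  \<comment> \<open>The gap between the LP value and the lower bound is exactly
    \<open>y0 - snd (Or hy)\<close>, which the stopping rule controls.\<close>
  also have "\<dots> \<le> aLB + epsL" using gap unfolding eq aLBr by linarith
  finally have "aUB \<le> aLB + epsL + L * (\<Sum>i<N. W1 (d i) (distr \<mu>h (M i) (\<lambda>x. x i)) (M i))"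
    using reassembly_cost_le[OF \<mu>h mut[folded \<mu>h_def]] unfolding eq(2) by linarith
  \<comment> \<open>The moment equations of the dual LP say that each marginal of
    \<open>\<mu>h\<close> has the same moments as \<open>M i\<close>.\<close>
  moreover have "W1 (d i) (distr \<mu>h (M i) (\<lambda>x. x i)) (M i) \<le> Wbar (d i) (M i) (g i) (m i)" if i: "i < N" for i
  proof (rule compact_metric_measure.W1_le_Wbar[OF cm[OF i] ps[OF i]])
    have c: "(\<lambda>x. x i) \<in> measurable \<mu>h (M i)"
      using i measurable_component_singleton[of i "{..<N}" M]
      by (simp cong: measurable_cong_sets add: \<mu>h)
    have "(\<integral>x. g i j x \<partial>distr \<mu>h (M i) (\<lambda>x. x i)) = (\<integral>x. g i j x \<partial>M i)" if j: "j < m i" for j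
    proof -
      have gm: "g i j \<in> borel_measurable (M i)" using gint[OF i j] by simp
      have "(\<lambda>x. g i j (x i)) \<in> borel_measurable ?P"
        by (rule measurable_compose[OF measurable_component_singleton[of i "{..<N}" M] gm]) (use i in simp)
      then have "(\<integral>x. g i j (x i) \<partial>\<mu>h) = (\<Sum>x\<in>S. g i j (x i) * w x)"
        unfolding \<mu>h_def by (intro integral_discrete_meas[OF S(1) SP w(1)])
      then show ?thesis using wg[OF i j] by (simp add: integral_distr[OF c gm] gbar_def)
    qed
    then show "distr \<mu>h (M i) (\<lambda>x. x i) \<in> moment_set (M i) (g i) (m i)"
      using prob_space.prob_space_distr[OF \<mu>h(1) c] by (simp add: moment_set_def)
  qed
  then have "L * (\<Sum>i<N. W1 (d i) (distr \<mu>h (M i) (\<lambda>x. x i)) (M i))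
      \<le> L * (\<Sum>i<N. Wbar (d i) (M i) (g i) (m i))"
    using L by (intro mult_left_mono sum_mono) auto
  ultimately show "epsSub \<le> epsL + L * (\<Sum>i<N. Wbar (d i) (M i) (g i) (m i))"
    unfolding eq(3) by linarith
qed

end

subsection \<open>Couplings glued along a partition of unity\<close>

text \<open>The kernel is the density of the mixture of products, with its first argument fixed.
  Where \<open>H v\<close> has mass 0, division by zero yields 0, which explains the case split on
  the right.\<close>

lemma nn_integral_partition_kernel:
  fixes H :: "'v \<Rightarrow> 'a \<Rightarrow> real"
  assumes V: "finite V" and int: "\<And>v. v \<in> V \<Longrightarrow> integrable \<nu> (H v)"
    and nonneg: "\<And>v y. v \<in> V \<Longrightarrow> y \<in> space \<nu> \<Longrightarrow> 0 \<le> H v y"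
    and x: "\<And>v. v \<in> V \<Longrightarrow> 0 \<le> H v x"
  shows "(\<integral>\<^sup>+y. ennreal (\<Sum>v\<in>V. H v x * H v y / (\<integral>z. H v z \<partial>\<nu>)) \<partial>\<nu>)
      = ennreal (\<Sum>v\<in>V. if (\<integral>z. H v z \<partial>\<nu>) = 0 then 0 else H v x)"
proof -
  have p: "0 \<le> (\<integral>z. H v z \<partial>\<nu>)" if "v \<in> V" for v
    using nonneg[OF that] by (intro integral_nonneg_AE AE_I2)
  have i: "integrable \<nu> (\<lambda>y. H v x * H v y / (\<integral>z. H v z \<partial>\<nu>))" if "v \<in> V" for v
    using int[OF that] by (intro integrable_divide integrable_mult_right)
  have "(\<integral>\<^sup>+y. ennreal (\<Sum>v\<in>V. H v x * H v y / (\<integral>z. H v z \<partial>\<nu>)) \<partial>\<nu>)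
      = ennreal (\<integral>y. (\<Sum>v\<in>V. H v x * H v y / (\<integral>z. H v z \<partial>\<nu>)) \<partial>\<nu>)"
  proof (rule nn_integral_eq_integral)
    show "integrable \<nu> (\<lambda>y. \<Sum>v\<in>V. H v x * H v y / (\<integral>z. H v z \<partial>\<nu>))"
      using i by (rule Bochner_Integration.integrable_sum)
    show "AE y in \<nu>. 0 \<le> (\<Sum>v\<in>V. H v x * H v y / (\<integral>z. H v z \<partial>\<nu>))"
      using p x nonneg by (intro AE_I2 sum_nonneg divide_nonneg_nonneg mult_nonneg_nonneg)
  qed
  also have "(\<integral>y. (\<Sum>v\<in>V. H v x * H v y / (\<integral>z. H v z \<partial>\<nu>)) \<partial>\<nu>)
      = (\<Sum>v\<in>V. \<integral>y. H v x * H v y / (\<integral>z. H v z \<partial>\<nu>) \<partial>\<nu>)"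
    using i by (rule Bochner_Integration.integral_sum)
  also have "\<dots> = (\<Sum>v\<in>V. if (\<integral>z. H v z \<partial>\<nu>) = 0 then 0 else H v x)"
    by (intro sum.cong) auto
  finally show ?thesis .
qed

text \<open>A nonnegative function with integral 0 vanishes almost everywhere, so the indices
  discarded by division by zero do not change the total.\<close>

lemma partition_kernel_AE_1:
  fixes H :: "'v \<Rightarrow> 'a \<Rightarrow> real"
  assumes V: "finite V" and int: "\<And>v. v \<in> V \<Longrightarrow> integrable \<mu> (H v)"
    and nonneg: "\<And>v x. v \<in> V \<Longrightarrow> x \<in> space \<mu> \<Longrightarrow> 0 \<le> H v x"
    and sum1: "\<And>x. x \<in> space \<mu> \<Longrightarrow> (\<Sum>v\<in>V. H v x) = 1"
  shows "AE x in \<mu>. (\<Sum>v\<in>V. if (\<integral>z. H v z \<partial>\<mu>) = 0 then 0 else H v x) = 1"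
proof -
  have "AE x in \<mu>. (\<integral>z. H v z \<partial>\<mu>) = 0 \<longrightarrow> H v x = 0" if "v \<in> V" for v
  proof (cases "(\<integral>z. H v z \<partial>\<mu>) = 0")
    case True
    then show ?thesis
      using integral_nonneg_eq_0_iff_AE[OF int[OF that]] nonneg[OF that] by auto
  qed simp
  then have "AE x in \<mu>. \<forall>v\<in>V. (\<integral>z. H v z \<partial>\<mu>) = 0 \<longrightarrow> H v x = 0"
    using V by (simp add: AE_ball_countable countable_finite)
  then show ?thesis
  proof (rule AE_mp, intro AE_I2 impI)
    fix x assume x: "x \<in> space \<mu>" "\<forall>v\<in>V. (\<integral>z. H v z \<partial>\<mu>) = 0 \<longrightarrow> H v x = 0"
    then have "(\<Sum>v\<in>V. if (\<integral>z. H v z \<partial>\<mu>) = 0 then 0 else H v x) = (\<Sum>v\<in>V. H v x)"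
      by (intro sum.cong) auto
    then show "(\<Sum>v\<in>V. if (\<integral>z. H v z \<partial>\<mu>) = 0 then 0 else H v x) = 1" using sum1 x by simp
  qed
qed

text \<open>Gluing along a partition of unity: with \<open>p v\<close> the common integral of \<open>H v\<close>, the coupling
  is the mixture of the products of \<open>H v \<mu> / p v\<close> and \<open>H v \<nu> / p v\<close> with weights \<open>p v\<close>.\<close>

lemma (in compact_metric_measure) W1_le_partition:
  fixes H :: "'v \<Rightarrow> 'a \<Rightarrow> real"
  assumes \<mu>: "prob_space \<mu>" and \<nu>: "prob_space \<nu>" "sets \<nu> = sets \<mu>" and V: "finite V"
    and meas: "\<And>v. v \<in> V \<Longrightarrow> H v \<in> borel_measurable \<mu>"
    and nonneg: "\<And>v x. v \<in> V \<Longrightarrow> x \<in> X \<Longrightarrow> 0 \<le> H v x"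
    and sum1: "\<And>x. x \<in> X \<Longrightarrow> (\<Sum>v\<in>V. H v x) = 1"
    and same: "\<And>v. v \<in> V \<Longrightarrow> (\<integral>x. H v x \<partial>\<nu>) = (\<integral>x. H v x \<partial>\<mu>)"
    and small: "\<And>v x y. v \<in> V \<Longrightarrow> x \<in> X \<Longrightarrow> y \<in> X \<Longrightarrow> H v x > 0 \<Longrightarrow> H v y > 0 \<Longrightarrow> d x y \<le> B"
  shows "W1 d \<mu> \<nu> \<le> B"
proof -
  interpret a: prob_space \<mu> by fact
  interpret b: prob_space \<nu> by fact
  interpret ab: pair_prob_space \<mu> \<nu> ..
  have sp: "space \<mu> = X" "space \<nu> = X" using \<nu>(2) sets_eq_imp_space_eq space_eq by metis+
  have measb: "H v \<in> borel_measurable \<nu>" if "v \<in> V" for v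
    using meas[OF that] \<nu>(2) by (simp cong: measurable_cong_sets)
  have le1: "H v x \<le> 1" if "v \<in> V" "x \<in> X" for v x
    using member_le_sum[OF that(1), of "\<lambda>v. H v x"] nonneg that V sum1[of x] by auto
  have inta: "integrable \<mu> (H v)" and intb: "integrable \<nu> (H v)" if "v \<in> V" for v
    using that le1 nonneg meas measb
    by (auto intro!: a.integrable_const_bound[of _ 1] b.integrable_const_bound[of _ 1] simp: sp)
  define p where "p v = (\<integral>x. H v x \<partial>\<mu>)" for v
  \<comment> \<open>The mixture weight \<open>p v\<close> cancels one of the two normalising factors
    \<open>1 / p v\<close>. The kernel is symmetric, so both marginals come from the same
    computation.\<close>
  define k where "k z = (\<Sum>v\<in>V. H v (fst z) * H v (snd z) / p v)" for z
  have k_meas [measurable]: "k \<in> borel_measurable (\<mu> \<Otimes>\<^sub>M \<nu>)"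
    unfolding k_def using meas measb
    by (intro borel_measurable_sum borel_measurable_divide borel_measurable_times
        measurable_compose[OF measurable_fst] measurable_compose[OF measurable_snd]) auto
  \<comment> \<open>Integrating out \<open>y\<close> produces the \<open>\<nu>\<close>-mass of
    \<open>H v\<close>; \<open>same\<close> identifies it with \<open>p v\<close>.\<close>
  have kx: "(\<integral>\<^sup>+y. ennreal (k (x, y)) \<partial>\<nu>) = ennreal (\<Sum>v\<in>V. if p v = 0 then 0 else H v x)" if "x \<in> X" for x
    using nn_integral_partition_kernel[OF V intb, where x=x] nonneg that
    by (simp add: k_def p_def sp same cong: sum.cong)
  have ky: "(\<integral>\<^sup>+x. ennreal (k (x, y)) \<partial>\<mu>) = ennreal (\<Sum>v\<in>V. if p v = 0 then 0 else H v y)" if "y \<in> X" for y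
    using nn_integral_partition_kernel[OF V inta, where x=y] nonneg that
    by (simp add: k_def p_def sp mult.commute cong: sum.cong)
  have AEa: "AE x in \<mu>. (\<Sum>v\<in>V. if p v = 0 then 0 else H v x) = 1"
    unfolding p_def using nonneg sum1 by (intro partition_kernel_AE_1 V inta) (auto simp: sp)
  have "AE x in \<nu>. (\<Sum>v\<in>V. if (\<integral>z. H v z \<partial>\<nu>) = 0 then 0 else H v x) = 1"
    using nonneg sum1 by (intro partition_kernel_AE_1 V intb) (auto simp: sp)
  then have AEb: "AE x in \<nu>. (\<Sum>v\<in>V. if p v = 0 then 0 else H v x) = 1"
    by (simp add: p_def same cong: sum.cong)
  define \<pi> where "\<pi> = density (\<mu> \<Otimes>\<^sub>M \<nu>) (\<lambda>z. ennreal (k z))"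
  have s\<pi>: "sets \<pi> = sets (\<mu> \<Otimes>\<^sub>M \<nu>)" "space \<pi> = space (\<mu> \<Otimes>\<^sub>M \<nu>)" by (simp_all add: \<pi>_def)
  have fst_m: "fst \<in> measurable \<pi> \<mu>" and snd_m: "snd \<in> measurable \<pi> \<nu>"
    using measurable_fst[of \<mu> \<nu>] measurable_snd[of \<mu> \<nu>] by (simp_all cong: measurable_cong_sets add: s\<pi>)
  have em: "emeasure \<pi> E = (\<integral>\<^sup>+z. ennreal (k z) * indicator E z \<partial>(\<mu> \<Otimes>\<^sub>M \<nu>))"
    if "E \<in> sets (\<mu> \<Otimes>\<^sub>M \<nu>)" for E
    unfolding \<pi>_def using that by (intro emeasure_density) auto
  have d1: "distr \<pi> \<mu> fst = \<mu>"
  proof (rule measure_eqI)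
    fix A assume "A \<in> sets (distr \<pi> \<mu> fst)"
    then have A [measurable]: "A \<in> sets \<mu>" by simp
    have E: "fst -` A \<inter> space (\<mu> \<Otimes>\<^sub>M \<nu>) \<in> sets (\<mu> \<Otimes>\<^sub>M \<nu>)" using A by measurable
    have "emeasure (distr \<pi> \<mu> fst) A = (\<integral>\<^sup>+z. ennreal (k z) * indicator A (fst z) \<partial>(\<mu> \<Otimes>\<^sub>M \<nu>))"
      unfolding emeasure_distr[OF fst_m A] s\<pi> em[OF E]
      by (intro nn_integral_cong) (auto simp: indicator_def)
    also have "\<dots> = (\<integral>\<^sup>+x. \<integral>\<^sup>+y. ennreal (k (x, y)) * indicator A x \<partial>\<nu> \<partial>\<mu>)"
      by (subst b.nn_integral_fst[symmetric]) simp_all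
    also have "\<dots> = (\<integral>\<^sup>+x. ennreal (\<Sum>v\<in>V. if p v = 0 then 0 else H v x) * indicator A x \<partial>\<mu>)"
      using k_meas by (intro nn_integral_cong) (simp add: nn_integral_multc kx sp)
    also have "\<dots> = (\<integral>\<^sup>+x. indicator A x \<partial>\<mu>)"
      using AEa by (intro nn_integral_cong_AE) auto
    finally show "emeasure (distr \<pi> \<mu> fst) A = emeasure \<mu> A" by simp
  qed simp
  have d2: "distr \<pi> \<nu> snd = \<nu>"
  proof (rule measure_eqI)
    fix A assume "A \<in> sets (distr \<pi> \<nu> snd)"
    then have A [measurable]: "A \<in> sets \<nu>" by simp
    have E: "snd -` A \<inter> space (\<mu> \<Otimes>\<^sub>M \<nu>) \<in> sets (\<mu> \<Otimes>\<^sub>M \<nu>)" using A by measurable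
    have "emeasure (distr \<pi> \<nu> snd) A = (\<integral>\<^sup>+z. ennreal (k z) * indicator A (snd z) \<partial>(\<mu> \<Otimes>\<^sub>M \<nu>))"
      unfolding emeasure_distr[OF snd_m A] s\<pi> em[OF E]
      by (intro nn_integral_cong) (auto simp: indicator_def)
    also have "\<dots> = (\<integral>\<^sup>+y. \<integral>\<^sup>+x. ennreal (k (x, y)) * indicator A y \<partial>\<mu> \<partial>\<nu>)"
      by (subst ab.nn_integral_snd[symmetric]) simp_all
    also have "\<dots> = (\<integral>\<^sup>+y. ennreal (\<Sum>v\<in>V. if p v = 0 then 0 else H v y) * indicator A y \<partial>\<nu>)"
      using k_meas by (intro nn_integral_cong) (simp add: nn_integral_multc ky sp)
    also have "\<dots> = (\<integral>\<^sup>+y. indicator A y \<partial>\<nu>)"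
      using AEb by (intro nn_integral_cong_AE) auto
    finally show "emeasure (distr \<pi> \<nu> snd) A = emeasure \<nu> A" by simp
  qed simp
  have "prob_space \<pi>"
    by (rule prob_space_distrD[OF fst_m]) (simp add: d1 \<mu>)
  then have "\<pi> \<in> couplings2 \<mu> \<nu>" using d1 d2 s\<pi> by (simp add: couplings2_def)
  moreover have "AE z in \<pi>. d (fst z) (snd z) \<le> B"
  proof -
    \<comment> \<open>A positive sum has a nonzero term, so one common \<open>H v\<close> is
      positive at both points.\<close>
    have "d (fst z) (snd z) \<le> B" if z: "z \<in> space (\<mu> \<Otimes>\<^sub>M \<nu>)" and pos: "0 < k z" for z
    proof -
      have zX: "fst z \<in> X" "snd z \<in> X" using z by (auto simp: space_pair_measure sp)
      have "\<exists>v\<in>V. H v (fst z) * H v (snd z) / p v \<noteq> 0"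
      proof (rule ccontr)
        assume "\<not> ?thesis"
        then have "k z = 0" unfolding k_def by (intro sum.neutral) blast
        then show False using pos by simp
      qed
      then obtain v where v: "v \<in> V" "H v (fst z) * H v (snd z) / p v \<noteq> 0" by blast
      then have "H v (fst z) \<noteq> 0" "H v (snd z) \<noteq> 0" by auto
      then have "H v (fst z) > 0" "H v (snd z) > 0"
        using nonneg[OF v(1) zX(1)] nonneg[OF v(1) zX(2)] by auto
      then show ?thesis using small v zX by blast
    qed
    then have "AE z in \<mu> \<Otimes>\<^sub>M \<nu>. 0 < ennreal (k z) \<longrightarrow> d (fst z) (snd z) \<le> B"
      by (intro AE_I2 impI) simp
    moreover have "(\<lambda>z. ennreal (k z)) \<in> borel_measurable (\<mu> \<Otimes>\<^sub>M \<nu>)" by measurable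
    ultimately show ?thesis unfolding \<pi>_def by (simp add: AE_density)
  qed
  ultimately show ?thesis by (rule W1_le[OF refl \<nu>(2)])
qed

text \<open>One test function may be dropped because the whole family sums to 1.\<close>

lemma (in compact_metric_measure) Wbar_le_partition:
  fixes H :: "'v \<Rightarrow> 'a \<Rightarrow> real"
  assumes \<mu>: "prob_space \<mu>" and V: "finite V"
    and meas: "\<And>v. v \<in> V \<Longrightarrow> H v \<in> borel_measurable \<mu>"
    and nonneg: "\<And>v x. v \<in> V \<Longrightarrow> x \<in> X \<Longrightarrow> 0 \<le> H v x"
    and sum1: "\<And>x. x \<in> X \<Longrightarrow> (\<Sum>v\<in>V. H v x) = 1"
    and small: "\<And>v x y. v \<in> V \<Longrightarrow> x \<in> X \<Longrightarrow> y \<in> X \<Longrightarrow> H v x > 0 \<Longrightarrow> H v y > 0 \<Longrightarrow> d x y \<le> B"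
    and v0: "v0 \<in> V" and vt: "bij_betw vt {..<m} (V - {v0})"
    and g: "\<And>j x. j < m \<Longrightarrow> x \<in> X \<Longrightarrow> g j x = H (vt j) x"
  shows "Wbar d \<mu> g m \<le> B"
  unfolding Wbar_def
proof (rule cSUP_least)
  show "moment_set \<mu> g m \<noteq> {}" using \<mu> by (auto simp: moment_set_def)
  fix \<nu> assume "\<nu> \<in> moment_set \<mu> g m"
  then have \<nu>: "prob_space \<nu>" "sets \<nu> = sets \<mu>"
    and mom: "\<And>j. j < m \<Longrightarrow> (\<integral>x. g j x \<partial>\<nu>) = (\<integral>x. g j x \<partial>\<mu>)" by (auto simp: moment_set_def)
  interpret a: prob_space \<mu> by fact
  interpret b: prob_space \<nu> by fact
  have sp: "space \<mu> = X" "space \<nu> = X" using \<nu>(2) sets_eq_imp_space_eq space_eq by metis+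
  have le1: "H v x \<le> 1" if "v \<in> V" "x \<in> X" for v x
    using member_le_sum[OF that(1), of "\<lambda>v. H v x"] nonneg that V sum1[of x] by auto
  have measb: "H v \<in> borel_measurable \<nu>" if "v \<in> V" for v
    using meas[OF that] \<nu>(2) by (simp cong: measurable_cong_sets)
  have inta: "integrable \<mu> (H v)" and intb: "integrable \<nu> (H v)" if "v \<in> V" for v
    using that le1 nonneg meas measb
    by (auto intro!: a.integrable_const_bound[of _ 1] b.integrable_const_bound[of _ 1] simp: sp)
  have others: "(\<integral>x. H v x \<partial>\<nu>) = (\<integral>x. H v x \<partial>\<mu>)" if "v \<in> V - {v0}" for v
  proof -
    have "v \<in> vt ` {..<m}" using bij_betw_imp_surj_on[OF vt] that by simp
    then obtain j where j: "j < m" "v = vt j" by blast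
    have "(\<integral>x. H v x \<partial>\<nu>) = (\<integral>x. g j x \<partial>\<nu>)" "(\<integral>x. H v x \<partial>\<mu>) = (\<integral>x. g j x \<partial>\<mu>)"
      using g[OF j(1)] j(2) by (auto intro!: Bochner_Integration.integral_cong simp: sp)
    then show ?thesis using mom[OF j(1)] by simp
  qed
  have "(\<Sum>v\<in>V. \<integral>x. H v x \<partial>\<nu>) = (\<integral>x. (\<Sum>v\<in>V. H v x) \<partial>\<nu>)"
    using intb by (intro Bochner_Integration.integral_sum[symmetric])
  also have "\<dots> = (\<integral>x. 1 \<partial>\<nu>)" using sum1 by (intro Bochner_Integration.integral_cong) (auto simp: sp)
  also have "\<dots> = (\<integral>x. 1 \<partial>\<mu>)" by (simp add: a.prob_space b.prob_space)
  also have "\<dots> = (\<integral>x. (\<Sum>v\<in>V. H v x) \<partial>\<mu>)" using sum1 by (intro Bochner_Integration.integral_cong) (auto simp: sp)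
  also have "\<dots> = (\<Sum>v\<in>V. \<integral>x. H v x \<partial>\<mu>)"
    using inta by (intro Bochner_Integration.integral_sum)
  finally have "(\<Sum>v\<in>V. \<integral>x. H v x \<partial>\<nu>) = (\<Sum>v\<in>V. \<integral>x. H v x \<partial>\<mu>)" .
  moreover have "(\<Sum>v\<in>V - {v0}. \<integral>x. H v x \<partial>\<nu>) = (\<Sum>v\<in>V - {v0}. \<integral>x. H v x \<partial>\<mu>)"
    using others by (intro sum.cong refl)
  ultimately have "(\<integral>x. H v0 x \<partial>\<nu>) = (\<integral>x. H v0 x \<partial>\<mu>)"
    by (simp add: sum.remove[OF V v0])
  then have "(\<integral>x. H v x \<partial>\<nu>) = (\<integral>x. H v x \<partial>\<mu>)" if "v \<in> V" for v
    using others that by (cases "v = v0") auto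
  then show "W1 d \<mu> \<nu> \<le> B"
    by (intro W1_le_partition[OF \<mu> \<nu> V meas nonneg sum1 _ small])
qed

subsection \<open>Polyhedral covers\<close>

text \<open>\<open>nrm\<close> is a function, not the norm of the type. It is continuous, so on the
  compact Euclidean unit sphere it has a positive minimum. This gives the half of the equivalence of
  norms that makes \<open>\<phi>\<close> continuous.\<close>

lemma is_norm_lower_bound:
  fixes nrm :: "'e::euclidean_space \<Rightarrow> real"
  assumes nrm: "is_norm nrm"
  obtains K where "\<And>x. norm x \<le> K * nrm x"
proof -
  have nn: "nrm x \<ge> 0" and z: "nrm x = 0 \<longleftrightarrow> x = 0" and sc: "nrm (c *\<^sub>R x) = \<bar>c\<bar> * nrm x"
    and tri: "nrm (x + y) \<le> nrm x + nrm y" for x y c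
    using nrm unfolding is_norm_def by blast+
  define C where "C = (\<Sum>b\<in>Basis. nrm b)"
  have sum_le: "nrm (\<Sum>b\<in>A. h b) \<le> (\<Sum>b\<in>A. nrm (h b))" if "finite A" for A :: "'e set" and h
    using that
  proof (induction A rule: finite_induct)
    case (insert a A)
    then show ?case using tri[of "h a" "\<Sum>b\<in>A. h b"] by simp
  qed (use z[of 0] in simp)
  have upper: "nrm x \<le> C * norm x" for x
  proof -
    have "nrm x = nrm (\<Sum>b\<in>Basis. (x \<bullet> b) *\<^sub>R b)" by (simp add: euclidean_representation)
    also have "\<dots> \<le> (\<Sum>b\<in>Basis. nrm ((x \<bullet> b) *\<^sub>R b))" by (rule sum_le) simp
    also have "\<dots> \<le> (\<Sum>b\<in>Basis. norm x * nrm b)"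
      unfolding sc by (intro sum_mono mult_right_mono Basis_le_norm nn)
    finally show ?thesis by (simp add: C_def sum_distrib_left mult.commute)
  qed
  have lip: "\<bar>nrm x - nrm y\<bar> \<le> C * norm (x - y)" for x y
  proof -
    have "nrm x \<le> nrm y + nrm (x - y)" "nrm y \<le> nrm x + nrm (y - x)"
      using tri[of y "x - y"] tri[of x "y - x"] by simp_all
    moreover have "nrm (y - x) = nrm (x - y)" using sc[of "-1" "x - y"] by simp
    ultimately show ?thesis using upper[of "x - y"] by linarith
  qed
  have "C-lipschitz_on UNIV nrm"
    using lip by (auto simp: lipschitz_on_def dist_norm C_def nn intro!: sum_nonneg)
  then have cont: "continuous_on UNIV nrm" by (rule lipschitz_on_continuous_on)
  have "compact (sphere (0::'e) 1)" "sphere (0::'e) 1 \<noteq> {}" by auto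
  then obtain u :: 'e where u: "u \<in> sphere 0 1" "\<And>y. y \<in> sphere 0 1 \<Longrightarrow> nrm u \<le> nrm y"
    using continuous_attains_inf[of "sphere (0::'e) 1" nrm] continuous_on_subset[OF cont] by blast
  have "nrm u \<noteq> 0" using u(1) z[of u] by auto
  then have upos: "nrm u > 0" using nn[of u] by simp
  have "norm x \<le> (1 / nrm u) * nrm x" for x
  proof (cases "x = 0")
    case False
    have "nrm x = norm x * nrm ((1 / norm x) *\<^sub>R x)" using False by (simp add: sc)
    moreover have "nrm u \<le> nrm ((1 / norm x) *\<^sub>R x)" using False by (intro u(2)) simp
    ultimately have "norm x * nrm u \<le> nrm x" by (simp add: mult_left_mono)
    then show ?thesis using upos by (simp add: field_simps)
  qed (simp add: nn upos)
  then show ?thesis by (rule that)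
qed

lemma (in compact_metric_measure) euc_repr_continuous_map:
  fixes \<phi> :: "'a \<Rightarrow> 'e::euclidean_space"
  assumes "euc_repr X d \<phi> nrm S"
  shows "continuous_map mtopology euclidean \<phi>"
proof -
  have nrm: "is_norm nrm" and d: "\<And>x y. x \<in> X \<Longrightarrow> y \<in> X \<Longrightarrow> d x y = nrm (\<phi> x - \<phi> y)"
    using assms by (simp_all add: euc_repr_def)
  obtain K where "\<And>x. norm x \<le> K * nrm x" using is_norm_lower_bound[OF nrm] by blast
  then show ?thesis by (intro lipschitz_continuous_map[of \<phi> K]) (simp add: d dist_norm)
qed

lemma bounded_cover_cell:
  assumes "bounded_polyhedral_cover \<CC> Y" "C \<in> \<CC>"
  shows "finite (vertices C)" "C = convex hull (vertices C)" "convex C" "closed C"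
proof -
  have C: "polyhedron C" "bounded C"
    using assms by (auto simp: bounded_polyhedral_cover_def polyhedral_cover_def)
  then show "finite (vertices C)" "convex C" "closed C"
    by (auto simp: vertices_def finite_polyhedron_extreme_points polyhedron_imp_convex polyhedron_imp_closed)
  show "C = convex hull (vertices C)"
    using C Krein_Milman_Minkowski[of C] unfolding vertices_def
    by (simp add: polyhedron_imp_convex polyhedron_imp_closed compact_eq_bounded_closed)
qed

lemma finite_cover_vertices:
  "bounded_polyhedral_cover \<CC> Y \<Longrightarrow> finite (cover_vertices \<CC>)"
  using bounded_cover_cell(1)
  by (auto simp: cover_vertices_def bounded_polyhedral_cover_def polyhedral_cover_def)

text \<open>\<open>eta\<close> compares vertices only. Balls of \<open>nrm\<close> around
  \<open>v\<close> are convex and a bounded cell is the hull of its vertices, so the bound passes to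
  the entire cell.\<close>

lemma nrm_vertex_le_eta:
  fixes \<CC> :: "'e::euclidean_space set set"
  assumes nrm: "is_norm nrm" and cov: "bounded_polyhedral_cover \<CC> Y"
    and C: "C \<in> \<CC>" and x: "x \<in> C" and v: "v \<in> vertices C"
  shows "nrm (x - v) \<le> eta nrm \<CC>"
proof -
  have sc: "nrm (c *\<^sub>R x) = \<bar>c\<bar> * nrm x" and tri: "nrm (x + y) \<le> nrm x + nrm y" for x y c
    using nrm unfolding is_norm_def by blast+
  define D where "D C = {nrm (v - v') | v v'. v \<in> vertices C \<and> v' \<in> vertices C}" for C
  have "D C = (\<lambda>(v, v'). nrm (v - v')) ` (vertices C \<times> vertices C)" by (auto simp: D_def)
  then have finD: "finite (D C)" using bounded_cover_cell(1)[OF cov C] by simp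
  have finC: "finite \<CC>" using cov by (simp add: bounded_polyhedral_cover_def polyhedral_cover_def)
  have w: "nrm (w - v) \<le> eta nrm \<CC>" if "w \<in> vertices C" for w
  proof -
    have "nrm (w - v) \<in> D C" using that v by (auto simp: D_def)
    then have "nrm (w - v) \<le> Max (D C)" using finD by simp
    also have "\<dots> \<le> Max ((\<lambda>C. Max (D C)) ` \<CC>)" using finC C by simp
    finally show ?thesis by (simp add: eta_def D_def)
  qed
  have "convex {x. nrm (x - v) \<le> eta nrm \<CC>}"
  proof (rule convexI)
    fix a b and s t :: real
    assume ab: "a \<in> {x. nrm (x - v) \<le> eta nrm \<CC>}" "b \<in> {x. nrm (x - v) \<le> eta nrm \<CC>}"
      and st: "0 \<le> s" "0 \<le> t" "s + t = 1"
    have "s *\<^sub>R v + t *\<^sub>R v = v" using st(3) by (simp flip: scaleR_left_distrib)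
    moreover have "s *\<^sub>R (a - v) + t *\<^sub>R (b - v) = s *\<^sub>R a + t *\<^sub>R b - (s *\<^sub>R v + t *\<^sub>R v)"
      by (simp add: scaleR_diff_right)
    ultimately have "s *\<^sub>R a + t *\<^sub>R b - v = s *\<^sub>R (a - v) + t *\<^sub>R (b - v)" by simp
    then have "nrm (s *\<^sub>R a + t *\<^sub>R b - v) \<le> s * nrm (a - v) + t * nrm (b - v)"
      using tri[of "s *\<^sub>R (a - v)" "t *\<^sub>R (b - v)"] st by (simp add: sc)
    also have "\<dots> \<le> s * eta nrm \<CC> + t * eta nrm \<CC>"
      using ab st by (intro add_mono mult_left_mono) auto
    also have "\<dots> = eta nrm \<CC>" using st(3) by (simp flip: distrib_right)
    finally show "s *\<^sub>R a + t *\<^sub>R b \<in> {x. nrm (x - v) \<le> eta nrm \<CC>}" by simp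
  qed
  then have "convex hull (vertices C) \<subseteq> {x. nrm (x - v) \<le> eta nrm \<CC>}"
    using w by (intro hull_minimal) auto
  then show ?thesis using x bounded_cover_cell(2)[OF cov C] by auto
qed

text \<open>The part of the interpolation property that the coupling argument needs, common to
  \<open>vif_set\<close> and \<open>barycentric_vif\<close>.\<close>

definition cell_partition :: "'e::euclidean_space set set \<Rightarrow> ('e \<Rightarrow> 'e \<Rightarrow> real) \<Rightarrow> bool" where
  "cell_partition \<CC> h \<longleftrightarrow> (\<forall>C\<in>\<CC>. \<forall>x\<in>C.
     (\<forall>v\<in>cover_vertices \<CC>. 0 \<le> h v x) \<and> (\<Sum>v\<in>vertices C. h v x) = 1 \<and>
     (\<forall>v\<in>cover_vertices \<CC> - vertices C. h v x = 0))"

lemma vif_set_cell_partition: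
  assumes "bounded_polyhedral_cover \<CC> Y" "vif_set \<CC> h"
  shows "cell_partition \<CC> h"
  unfolding cell_partition_def
proof (intro ballI)
  fix C x assume Cx: "C \<in> \<CC>" "x \<in> C"
  have "C face_of C" by (rule face_of_refl[OF bounded_cover_cell(3)[OF assms(1) Cx(1)]])
  then have C: "C \<in> cover_faces \<CC>" using Cx unfolding cover_faces_def by blast
  have "0 \<le> h v x" if "v \<in> cover_vertices \<CC>" for v
    using assms(2) that Cx by (auto simp add: vif_set_def)
  moreover have "(\<Sum>v\<in>vertices C. h v x) = 1"
    using assms(2) C Cx(2) by (simp add: vif_set_def)
  moreover have "h v x = 0" if "v \<in> cover_vertices \<CC> - vertices C" for v
    using assms(2) C Cx(2) that by (simp add: vif_set_def)
  ultimately show "(\<forall>v\<in>cover_vertices \<CC>. 0 \<le> h v x) \<and> (\<Sum>v\<in>vertices C. h v x) = 1 \<and>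
     (\<forall>v\<in>cover_vertices \<CC> - vertices C. h v x = 0)" by blast
qed

section \<open>Barycentric coordinates on simplicial covers\<close>

text \<open>\<open>barycentric_vif\<close> prescribes values on relative interiors of faces. A point
  of a simplex lies in the relative interior of the face spanned by the generators with nonzero
  barycentric coordinate; at the other generators \<open>h\<close> is 0, so the identities extend to
  the closed simplex.\<close>

lemma barycentric_vif_simplex:
  assumes h: "barycentric_vif \<CC> h" and C: "C \<in> \<CC>"
    and T: "\<not> affine_dependent T" "C = convex hull T" and x: "x \<in> C"
  shows "\<forall>v\<in>T. 0 \<le> h v x" "(\<Sum>v\<in>T. h v x) = 1" "(\<Sum>v\<in>T. h v x *\<^sub>R v) = x"
    "\<forall>v\<in>cover_vertices \<CC> - T. h v x = 0"
proof -
  have vert: "vertices (convex hull T') = T'" if "T' \<subseteq> T" for T'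
    using extreme_point_of_convex_hull_affine_independent[OF affine_independent_subset[OF T(1) that]]
    by (auto simp: vertices_def)
  have fT: "finite T" using T(1) by (rule aff_independent_finite)
  obtain u where u: "\<forall>v\<in>T. 0 \<le> u v" "sum u T = 1" "(\<Sum>v\<in>T. u v *\<^sub>R v) = x"
    using x unfolding T(2) convex_hull_finite[OF fT] by blast
  define T' where "T' = {v\<in>T. u v \<noteq> 0}"
  have T': "T' \<subseteq> T" "finite T'" using fT by (auto simp: T'_def)
  define F where "F = convex hull T'"
  have ext: "(\<Sum>v\<in>T'. k v) = (\<Sum>v\<in>T. k v)" if "\<And>v. v \<in> T - T' \<Longrightarrow> k v = 0"
    for k :: "'a \<Rightarrow> 'b::comm_monoid_add"
    using fT T' that by (intro sum.mono_neutral_left) auto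
  have "x \<in> rel_interior F"
  proof -
    have "sum u T' = 1" "(\<Sum>v\<in>T'. u v *\<^sub>R v) = x"
      using u(2,3) ext[of u] ext[of "\<lambda>v. u v *\<^sub>R v"] by (auto simp: T'_def)
    moreover have "\<forall>v\<in>T'. 0 < u v" using u(1) by (auto simp: T'_def less_le)
    ultimately show ?thesis
      unfolding F_def rel_interior_convex_hull_explicit[OF affine_independent_subset[OF T(1) T'(1)]]
      by blast
  qed
  moreover have "F \<in> cover_faces \<CC>"
  proof -
    have "F face_of C" using T T' by (auto simp: F_def face_of_convex_hull_affine_independent)
    moreover have "F \<noteq> {}" using \<open>x \<in> rel_interior F\<close> rel_interior_subset by blast
    ultimately show ?thesis using C by (auto simp: cover_faces_def)
  qed
  moreover have "vertices F = T'" unfolding F_def by (rule vert[OF T'(1)])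
  ultimately have hx: "\<forall>w\<in>T'. h w x > 0" "(\<Sum>w\<in>T'. h w x) = 1" "(\<Sum>w\<in>T'. h w x *\<^sub>R w) = x"
    "\<forall>v\<in>cover_vertices \<CC> - T'. h v x = 0"
    using h[unfolded barycentric_vif_def, rule_format, of F x] by simp_all
  have TV: "T \<subseteq> cover_vertices \<CC>" using C vert[of T] T(2) by (auto simp: cover_vertices_def)
  have 0: "h v x = 0" if "v \<in> T - T'" for v using hx(4) TV that by blast
  show "\<forall>v\<in>T. 0 \<le> h v x"
  proof
    fix v assume "v \<in> T"
    then show "0 \<le> h v x" using hx(1) 0 by (cases "v \<in> T'") (auto intro: less_imp_le)
  qed
  show "(\<Sum>v\<in>T. h v x) = 1" using ext[of "\<lambda>v. h v x"] 0 hx(2) by simp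
  show "(\<Sum>v\<in>T. h v x *\<^sub>R v) = x" using ext[of "\<lambda>v. h v x *\<^sub>R v"] 0 hx(3) by simp
  show "\<forall>v\<in>cover_vertices \<CC> - T. h v x = 0" using hx(4) T'(1) by blast
qed

text \<open>The differences \<open>w - v\<close> with \<open>w \<noteq> v\<close> are linearly
  independent, so some linear \<open>l\<close> equals 1 on all of them and sums the coordinates
  other than \<open>u v\<close>. Barycentric coordinates are therefore affine in the point.\<close>

lemma affine_independent_coordinate:
  fixes T :: "'e::euclidean_space set"
  assumes T: "\<not> affine_dependent T" and v: "v \<in> T"
  obtains l :: "'e \<Rightarrow> real" where "linear l"
    "\<And>u. sum u T = 1 \<Longrightarrow> u v = 1 - l ((\<Sum>w\<in>T. u w *\<^sub>R w) - v)"
proof -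
  have fT: "finite T" using T by (rule aff_independent_finite)
  have "independent ((\<lambda>x. - v + x) ` (T - {v}))"
    using T affine_dependent_iff_dependent2[OF v] by simp
  then obtain l :: "'e \<Rightarrow> real" where l: "linear l" "\<forall>z\<in>(\<lambda>x. - v + x) ` (T - {v}). l z = 1"
    using linear_independent_extend[of _ "\<lambda>_. 1::real"] by metis
  have "u v = 1 - l ((\<Sum>w\<in>T. u w *\<^sub>R w) - v)" if u: "sum u T = 1" for u
  proof -
    have "(\<Sum>w\<in>T. u w *\<^sub>R v) = v" using u by (simp flip: scaleR_left.sum)
    then have "(\<Sum>w\<in>T. u w *\<^sub>R w) - v = (\<Sum>w\<in>T. u w *\<^sub>R (w - v))"
      by (simp add: scaleR_diff_right sum_subtractf)
    also have "l \<dots> = (\<Sum>w\<in>T. u w * l (w - v))"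
      using l(1) by (simp add: linear_sum linear_cmul)
    also have "\<dots> = (\<Sum>w\<in>T - {v}. u w * l (w - v))"
      using fT v linear_0[OF l(1)] by (simp add: sum.remove)
    also have "\<dots> = (\<Sum>w\<in>T - {v}. u w)" using l(2) by (intro sum.cong) auto
    also have "\<dots> = 1 - u v" using u fT v by (simp add: sum.remove)
    finally show ?thesis by simp
  qed
  then show ?thesis using l(1) that by blast
qed

lemma simplicial_cover_simplex:
  assumes "simplicial_cover S \<CC> Y" "C \<in> \<CC>"
  obtains "\<not> affine_dependent (vertices C)" "C = convex hull (vertices C)"
proof -
  have "int (dim S) simplex C" using assms by (simp add: simplicial_cover_def)
  then obtain T where T: "\<not> affine_dependent T" "C = convex hull T"
    unfolding simplex_def by blast
  then have "vertices C = T"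
    using extreme_point_of_convex_hull_affine_independent[OF T(1)] by (auto simp: vertices_def)
  then show ?thesis using T that by blast
qed

lemma barycentric_vif_cell_partition:
  assumes cov: "simplicial_cover S \<CC> Y" and h: "barycentric_vif \<CC> h"
  shows "cell_partition \<CC> h"
  unfolding cell_partition_def
proof (intro ballI conjI)
  fix C x assume Cx: "C \<in> \<CC>" "x \<in> C"
  obtain T: "\<not> affine_dependent (vertices C)" "C = convex hull (vertices C)"
    using simplicial_cover_simplex[OF cov Cx(1)] .
  note * = barycentric_vif_simplex[OF h Cx(1) T Cx(2)]
  show "(\<Sum>v\<in>vertices C. h v x) = 1" by (rule *)
  show "h v x = 0" if "v \<in> cover_vertices \<CC> - vertices C" for v using *(4) that by blast
  show "0 \<le> h v x" if "v \<in> cover_vertices \<CC>" for v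
    using *(1,4) that by (cases "v \<in> vertices C") auto
qed

text \<open>On each cell the function is affine or identically 0, and functions on finitely many
  closed cells can be pasted. Measurability of barycentric families comes from here.\<close>

lemma barycentric_vif_continuous:
  assumes cov: "simplicial_cover S \<CC> Y" and h: "barycentric_vif \<CC> h"
    and v: "v \<in> cover_vertices \<CC>"
  shows "continuous_on (\<Union>\<CC>) (h v)"
proof -
  have bcov: "bounded_polyhedral_cover \<CC> Y" using cov by (simp add: simplicial_cover_def)
  have "continuous_on (\<Union>C\<in>\<CC>. C) (h v)"
  proof (rule continuous_on_closed_Union)
    show "finite \<CC>" using bcov by (simp add: bounded_polyhedral_cover_def polyhedral_cover_def)
    fix C assume C: "C \<in> \<CC>"
    show "closed C" by (rule bounded_cover_cell(4)[OF bcov C])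
    obtain T: "\<not> affine_dependent (vertices C)" "C = convex hull (vertices C)"
      using simplicial_cover_simplex[OF cov C] .
    note * = barycentric_vif_simplex[OF h C T]
    show "continuous_on C (h v)"
    proof (cases "v \<in> vertices C")
      case False
      then have "h v x = 0" if "x \<in> C" for x using *(4)[OF that] v by blast
      then show ?thesis using continuous_on_cong[of C C "h v" "\<lambda>_. 0"] by simp
    next
      case True
      obtain l :: "_ \<Rightarrow> real" where l: "linear l"
        "\<And>u. sum u (vertices C) = 1 \<Longrightarrow> u v = 1 - l ((\<Sum>w\<in>vertices C. u w *\<^sub>R w) - v)"
        using affine_independent_coordinate[OF T(1) True] by blast
      have "h v x = 1 - l (x - v)" if "x \<in> C" for x
        using l(2)[of "\<lambda>w. h w x"] *(2,3)[OF that] by simp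
      moreover have "continuous_on C (\<lambda>x. 1 - l (x - v))"
        by (intro continuous_intros linear_continuous_on_compose[OF _ l(1)])
      ultimately show ?thesis using continuous_on_cong[of C C "h v"] by simp
    qed
  qed
  then show ?thesis by simp
qed

section \<open>Moment-set radius of interpolation families\<close>

context compact_metric_measure
begin

lemma Wbar_le_cover:
  fixes \<phi> :: "'a \<Rightarrow> 'e::euclidean_space"
  assumes \<mu>: "prob_space \<mu>" and \<phi>: "euc_repr X d \<phi> nrm S"
    and cov: "bounded_polyhedral_cover \<CC> (\<phi> ` X)" and h: "cell_partition \<CC> h"
    and meas: "\<And>v. v \<in> cover_vertices \<CC> \<Longrightarrow> (\<lambda>x. h v (\<phi> x)) \<in> borel_measurable \<mu>"
    and v0: "v0 \<in> cover_vertices \<CC>" and vt: "bij_betw vt {..<m} (cover_vertices \<CC> - {v0})"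
    and g: "\<And>j x. j < m \<Longrightarrow> x \<in> X \<Longrightarrow> g j x = h (vt j) (\<phi> x)"
  shows "Wbar d \<mu> g m \<le> 2 * eta nrm \<CC>"
proof -
  have nrm: "is_norm nrm" and d: "\<And>x y. x \<in> X \<Longrightarrow> y \<in> X \<Longrightarrow> d x y = nrm (\<phi> x - \<phi> y)"
    using \<phi> by (simp_all add: euc_repr_def)
  have sc: "nrm (c *\<^sub>R x) = \<bar>c\<bar> * nrm x" and tri: "nrm (x + y) \<le> nrm x + nrm y" for x y c
    using nrm unfolding is_norm_def by blast+
  have V: "finite (cover_vertices \<CC>)" by (rule finite_cover_vertices[OF cov])
  have "\<phi> ` X \<subseteq> \<Union>\<CC>" using cov by (simp add: bounded_polyhedral_cover_def polyhedral_cover_def)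
  then have cell: "\<exists>C\<in>\<CC>. \<phi> x \<in> C" if "x \<in> X" for x using that by blast
  have h0: "0 \<le> h v x" if "C \<in> \<CC>" "x \<in> C" "v \<in> cover_vertices \<CC>" for C x v
    using h that by (simp add: cell_partition_def)
  have h1: "(\<Sum>v\<in>vertices C. h v x) = 1" if "C \<in> \<CC>" "x \<in> C" for C x
    using h that by (simp add: cell_partition_def)
  have h2: "h v x = 0" if "C \<in> \<CC>" "x \<in> C" "v \<in> cover_vertices \<CC> - vertices C" for C x v
    using h that by (simp add: cell_partition_def)
  have near: "nrm (\<phi> x - v) \<le> eta nrm \<CC>"
    if "v \<in> cover_vertices \<CC>" "x \<in> X" "h v (\<phi> x) > 0" for v x
  proof -
    obtain C where C: "C \<in> \<CC>" "\<phi> x \<in> C" using cell[OF \<open>x \<in> X\<close>] by blast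
    \<comment> \<open>At a point of \<open>C\<close> only vertices of \<open>C\<close> carry weight,
      so positivity makes \<open>v\<close> a vertex of any cell that contains
      \<open>\<phi> x\<close>.\<close>
    then have "v \<in> vertices C" using h2[OF C] that by (cases "v \<in> vertices C") auto
    then show ?thesis by (rule nrm_vertex_le_eta[OF nrm cov C])
  qed
  show ?thesis
  proof (rule Wbar_le_partition[where V = "cover_vertices \<CC>" and H = "\<lambda>v x. h v (\<phi> x)",
        OF \<mu> V meas _ _ _ v0 vt])
    show "0 \<le> h v (\<phi> x)" if "v \<in> cover_vertices \<CC>" "x \<in> X" for v x
      using cell[OF that(2)] h0 that(1) by blast
    show "(\<Sum>v\<in>cover_vertices \<CC>. h v (\<phi> x)) = 1" if x: "x \<in> X" for x
    proof -
      obtain C where C: "C \<in> \<CC>" "\<phi> x \<in> C" using cell[OF x] by blast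
      then have "vertices C \<subseteq> cover_vertices \<CC>" by (auto simp: cover_vertices_def)
      moreover have "\<forall>v\<in>cover_vertices \<CC> - vertices C. h v (\<phi> x) = 0"
        "(\<Sum>v\<in>vertices C. h v (\<phi> x)) = 1"
        using h1[OF C] h2[OF C] by simp_all
      ultimately show ?thesis
        using sum.mono_neutral_left[OF V, of "vertices C" "\<lambda>v. h v (\<phi> x)"] by simp
    qed
    show "d x y \<le> 2 * eta nrm \<CC>"
      if "v \<in> cover_vertices \<CC>" "x \<in> X" "y \<in> X" "h v (\<phi> x) > 0" "h v (\<phi> y) > 0" for v x y
    proof -
      have "nrm ((\<phi> x - v) + (-1) *\<^sub>R (\<phi> y - v)) \<le> nrm (\<phi> x - v) + nrm ((-1) *\<^sub>R (\<phi> y - v))"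
        by (rule tri)
      also have "nrm ((-1) *\<^sub>R (\<phi> y - v)) = nrm (\<phi> y - v)"
        unfolding sc by simp
      finally show ?thesis using near[OF that(1,2,4)] near[OF that(1,3,5)] d[OF that(2,3)] by simp
    qed
  qed (simp_all add: g)
qed

text \<open>The Bochner integral of a non-integrable function is 0. Hence the positive integrals in
  \<open>BSSb_i\<close> encode both measurability and integrability of the interpolation
  functions.\<close>

lemma integrable_if_integral_pos:
  fixes h :: "'a \<Rightarrow> real"
  shows "(\<integral>x. h x \<partial>\<mu>) > 0 \<Longrightarrow> integrable \<mu> h"
  using not_integrable_integral_eq by fastforce

lemma integrable_cong_space:
  fixes g h :: "'a \<Rightarrow> real"
  assumes "integrable \<mu> h" "\<And>x. x \<in> X \<Longrightarrow> g x = h x"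
  shows "integrable \<mu> g"
  using assms Bochner_Integration.integrable_cong[of \<mu> \<mu> g h] by (simp add: space_eq)

lemma continuous_map_integrable:
  fixes h :: "'a \<Rightarrow> real"
  assumes \<mu>: "prob_space \<mu>" and h: "continuous_map mtopology euclidean h"
  shows "integrable \<mu> h"
proof -
  interpret prob_space \<mu> by fact
  have "compactin mtopology X" using compact by (simp add: compact_space_def)
  then have "compact (h ` X)" using image_compactin h by fastforce
  then obtain B where "\<And>x. x \<in> X \<Longrightarrow> norm (h x) \<le> B"
    by (meson bounded_iff compact_imp_bounded imageI)
  then show ?thesis
    using continuous_map_measurable[OF h]
    by (intro integrable_const_bound[of _ B] AE_I2) (simp_all add: space_eq)
qed

lemma BSSa_integrable:
  assumes "prob_space \<mu>" "BSSa_i X d \<mu> m g" "j < m"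
  shows "integrable \<mu> (g j)"
  using assms by (intro continuous_map_integrable) (simp_all add: BSSa_i_def mtop_def)

lemma BSSb_props:
  fixes \<phi> :: "'a \<Rightarrow> 'e::euclidean_space"
  assumes \<mu>: "prob_space \<mu>" and b: "BSSb_i X d \<mu> m g \<phi> nrm S \<CC>"
  shows "j < m \<Longrightarrow> integrable \<mu> (g j)" and "Wbar d \<mu> g m \<le> 2 * eta nrm \<CC>"
proof -
  obtain h vt where h: "vif_set \<CC> h" and vt: "bij_betw vt {..m} (cover_vertices \<CC>)"
    and pos: "\<And>j. j \<le> m \<Longrightarrow> (\<integral>x. h (vt j) (\<phi> x) \<partial>\<mu>) > 0"
    and g: "\<And>j x. j < m \<Longrightarrow> x \<in> X \<Longrightarrow> g j x = h (vt (Suc j)) (\<phi> x)"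
    using b unfolding BSSb_i_def by (elim conjE exE) (rule that; simp)
  have \<phi>: "euc_repr X d \<phi> nrm S" and cov: "bounded_polyhedral_cover \<CC> (\<phi> ` X)"
    using b by (simp_all add: BSSb_i_def)
  show "integrable \<mu> (g j)" if "j < m"
  proof (rule integrable_cong_space)
    show "integrable \<mu> (\<lambda>x. h (vt (Suc j)) (\<phi> x))"
      using that by (intro integrable_if_integral_pos pos) simp
  qed (rule g[OF that])
  show "Wbar d \<mu> g m \<le> 2 * eta nrm \<CC>"
  proof (rule Wbar_le_cover[where h = h and vt = "\<lambda>j. vt (Suc j)" and ?v0.0 = "vt 0",
        OF \<mu> \<phi> cov vif_set_cell_partition[OF cov h]])
    show "(\<lambda>x. h v (\<phi> x)) \<in> borel_measurable \<mu>" if "v \<in> cover_vertices \<CC>" for v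
    proof -
      have "v \<in> vt ` {..m}" using bij_betw_imp_surj_on[OF vt] that by simp
      then obtain j where "j \<le> m" "v = vt j" by blast
      then show ?thesis using borel_measurable_integrable[OF integrable_if_integral_pos[OF pos]] by simp
    qed
    show "vt 0 \<in> cover_vertices \<CC>" using bij_betwE[OF vt] by simp
    \<comment> \<open>The \<open>m + 1\<close> functions are enumerated by \<open>{..m}\<close> and
      index 0 is dropped; composing with \<open>Suc\<close> renumbers the others by
      \<open>{..<m}\<close>.\<close>
    have "bij_betw vt ({..m} - {0}) (cover_vertices \<CC> - {vt 0})"
      using bij_betwE[OF vt] by (intro bij_betw_DiffI[OF vt]) simp_all
    moreover have "bij_betw Suc {..<m} ({..m} - {0})"
    proof (rule bij_betwI')
      fix k assume "k \<in> {..m} - {0}"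
      then show "\<exists>j\<in>{..<m}. k = Suc j" by (cases k) auto
    qed auto
    ultimately show "bij_betw (\<lambda>j. vt (Suc j)) {..<m} (cover_vertices \<CC> - {vt 0})"
      using bij_betw_trans[of Suc "{..<m}" "{..m} - {0}" vt] by (simp add: comp_def)
  qed (rule g)
qed

lemma BSSa'_props:
  fixes \<phi> :: "'a \<Rightarrow> 'e::euclidean_space"
  assumes \<mu>: "prob_space \<mu>" and a: "BSSa'_i X d \<mu> m g \<phi> nrm S \<CC>"
  shows "j < m \<Longrightarrow> integrable \<mu> (g j)" and "Wbar d \<mu> g m \<le> 2 * eta nrm \<CC>"
proof -
  obtain h vt v0 where h: "barycentric_vif \<CC> h" and v0: "v0 \<in> cover_vertices \<CC>"
    and vt: "bij_betw vt {..<m} (cover_vertices \<CC> - {v0})"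
    and g: "\<And>j x. j < m \<Longrightarrow> x \<in> X \<Longrightarrow> g j x = h (vt j) (\<phi> x)"
    using a unfolding BSSa'_i_def by (elim conjE exE) (rule that; simp)
  have \<phi>: "euc_repr X d \<phi> nrm S" and scov: "simplicial_cover S \<CC> (\<phi> ` X)"
    using a by (simp_all add: BSSa'_i_def)
  then have cov: "bounded_polyhedral_cover \<CC> (\<phi> ` X)" by (simp add: simplicial_cover_def)
  have cont: "continuous_map mtopology euclidean (\<lambda>x. h v (\<phi> x))" if v: "v \<in> cover_vertices \<CC>" for v
  proof -
    have "\<phi> ` X \<subseteq> \<Union>\<CC>" using cov by (simp add: bounded_polyhedral_cover_def polyhedral_cover_def)
    then have 1: "continuous_map mtopology (top_of_set (\<Union>\<CC>)) \<phi>"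
      using euc_repr_continuous_map[OF \<phi>] by (simp add: continuous_map_in_subtopology image_subset_iff)
    have 2: "continuous_map (top_of_set (\<Union>\<CC>)) euclidean (h v)"
      using barycentric_vif_continuous[OF scov h v] by simp
    show ?thesis using continuous_map_compose[OF 1 2] by (simp add: comp_def)
  qed
  show "integrable \<mu> (g j)" if j: "j < m"
  proof (rule integrable_cong_space)
    have "vt j \<in> cover_vertices \<CC>" using bij_betwE[OF vt] j by simp
    then show "integrable \<mu> (\<lambda>x. h (vt j) (\<phi> x))" by (intro continuous_map_integrable \<mu> cont)
  qed (rule g[OF j])
  show "Wbar d \<mu> g m \<le> 2 * eta nrm \<CC>"
    by (rule Wbar_le_cover[where h = h and vt = vt and ?v0.0 = v0, OF \<mu> \<phi> cov barycentric_vif_cell_partition[OF scov h]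
          continuous_map_measurable[OF cont] v0 vt]) (simp_all add: g)
qed

end

theorem theorem4p9:
  fixes N :: nat and X :: "nat \<Rightarrow> 'a set" and d :: "nat \<Rightarrow> 'a \<Rightarrow> 'a \<Rightarrow> real"
    and M :: "nat \<Rightarrow> 'a measure" and f :: "(nat \<Rightarrow> 'a) \<Rightarrow> real" and L :: real
  assumes N_pos: "1 \<le> N"
    and metric: "\<forall>i<N. Metric_space (X i) (d i) \<and> compact_space (mtop (X i) (d i))"
    and meas: "\<forall>i<N. borel_prob_on (X i) (d i) (M i)"
    and L_pos: "L > 0"
    and lipschitz: "\<forall>x\<in>PiE {..<N} X. \<forall>y\<in>PiE {..<N} X. \<bar>f x - f y\<bar> \<le> L * (\<Sum>i<N. d i (x i) (y i))"
  shows
   "(\<forall>m g Or epsL \<rho> aUB aLB mut epsSub.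
       ((\<forall>i<N. BSSa_i (X i) (d i) (M i) (m i) (g i)) \<or>
        (\<forall>i<N. \<exists>(\<phi> :: 'a \<Rightarrow> 'e::euclidean_space) nrm S \<CC>. BSSb_i (X i) (d i) (M i) (m i) (g i) \<phi> nrm S \<CC>)) \<and>
       is_oracle (PiE {..<N} X) N m g f Or \<and> epsL > 0 \<and>
       alg2_output N X d M m g f Or epsL aUB aLB mut epsSub \<and>
       (\<forall>i<N. \<rho> i \<ge> Wbar (d i) (M i) (g i) (m i))
     \<longrightarrow> aLB \<le> (INF \<pi>\<in>couplings N M. \<integral>x. f x \<partial>\<pi>) \<and>
         (INF \<pi>\<in>couplings N M. \<integral>x. f x \<partial>\<pi>) \<le> aUB \<and>
         mut \<in> couplings N M \<and>
         (\<integral>x. f x \<partial>mut) \<le> (INF \<pi>\<in>couplings N M. \<integral>x. f x \<partial>\<pi>) + epsSub \<and>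
         epsSub \<le> epsL + L * (\<Sum>i<N. \<rho> i)) \<and>
    ((\<forall>i<N. \<exists>(\<phi> :: 'a \<Rightarrow> 'e) nrm S. euc_repr (X i) (d i) \<phi> nrm S \<and>
        (\<forall>e>0. \<exists>\<CC> mi gi. eta nrm \<CC> \<le> e \<and>
           (BSSa'_i (X i) (d i) (M i) mi gi \<phi> nrm S \<CC> \<or> BSSb_i (X i) (d i) (M i) mi gi \<phi> nrm S \<CC>)))
     \<longrightarrow> (\<forall>\<epsilon>>0. \<forall>epsL. 0 < epsL \<and> epsL < \<epsilon> \<longrightarrow>
          (\<exists>m g. (\<forall>i<N. \<exists>(\<phi> :: 'a \<Rightarrow> 'e) nrm S \<CC>.
                     BSSa'_i (X i) (d i) (M i) (m i) (g i) \<phi> nrm S \<CC> \<or> BSSb_i (X i) (d i) (M i) (m i) (g i) \<phi> nrm S \<CC>) \<and>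
             (\<forall>Or aUB aLB mut epsSub.
                is_oracle (PiE {..<N} X) N m g f Or \<and>
                alg2_output N X d M m g f Or epsL aUB aLB mut epsSub \<longrightarrow> epsSub \<le> \<epsilon>))))"
proof -
  have cm: "compact_metric_measure (X i) (d i) (M i)" and ps: "prob_space (M i)" if "i < N" for i
    using metric meas that
    by (simp_all add: compact_metric_measure_def compact_metric_measure_axioms_def mtop_def borel_prob_on_def)
  have lip: "\<bar>f x - f y\<bar> \<le> L * (\<Sum>i<N. d i (x i) (y i))"
    if "x \<in> PiE {..<N} X" "y \<in> PiE {..<N} X" for x y
    using lipschitz that by blast
  show ?thesis
  proof ((rule conjI; intro allI impI), goal_cases)
    case (1 m g Or epsL \<rho> aUB aLB mut epsSub)
    have gint: "integrable (M i) (g i j)" if "i < N" "j < m i" for i j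
    proof -
      interpret c: compact_metric_measure "X i" "d i" "M i" by (rule cm[OF that(1)])
      have "BSSa_i (X i) (d i) (M i) (m i) (g i) \<or>
          (\<exists>(\<phi> :: 'a \<Rightarrow> 'e) nrm S \<CC>. BSSb_i (X i) (d i) (M i) (m i) (g i) \<phi> nrm S \<CC>)"
        using 1 that(1) by blast
      then show ?thesis
        using c.BSSa_integrable[OF ps[OF that(1)] _ that(2)] c.BSSb_props(1)[OF ps[OF that(1)] _ that(2)]
        by (elim disjE exE) simp_all
    qed
    have Or: "is_oracle (PiE {..<N} X) N m g f Or"
      and out: "alg2_output N X d M m g f Or epsL aUB aLB mut epsSub"
      and \<rho>: "\<And>i. i < N \<Longrightarrow> Wbar (d i) (M i) (g i) (m i) \<le> \<rho> i" using 1 by simp_all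
    note b = alg2_output_bounds[OF cm ps L_pos lip gint Or out]
    have lb: "aLB \<le> (INF \<pi>\<in>couplings N M. \<integral>x. f x \<partial>\<pi>)"
      using b(1) by (intro cINF_greatest b(4)) auto
    \<comment> \<open>A real infimum lies below its family only if that family is bounded below;
      \<open>aLB\<close> is such a bound.\<close>
    have "bdd_below ((\<lambda>\<pi>. \<integral>x. f x \<partial>\<pi>) ` couplings N M)"
      by (rule bdd_belowI2) (rule b(4))
    then have ub: "(INF \<pi>\<in>couplings N M. \<integral>x. f x \<partial>\<pi>) \<le> (\<integral>x. f x \<partial>mut)"
      using b(1) by (rule cINF_lower)
    have "L * (\<Sum>i<N. Wbar (d i) (M i) (g i) (m i)) \<le> L * (\<Sum>i<N. \<rho> i)"
      using L_pos \<rho> by (intro mult_left_mono sum_mono) simp_all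
    then have "epsSub \<le> epsL + L * (\<Sum>i<N. \<rho> i)" using b(5) by linarith
    \<comment> \<open>\<open>mut\<close> costs \<open>aUB = aLB + epsSub\<close>, and
      \<open>aLB\<close> is at most the infimum.\<close>
    then show ?case using lb ub b(1-3) by simp
  next
    case (2 \<epsilon> epsL)
    \<comment> \<open>\<open>N\<close> marginals of radius at most \<open>2 * e\<close> each,
      multiplied by \<open>L\<close>, use up exactly \<open>\<epsilon> - epsL\<close>.\<close>
    define e where "e = (\<epsilon> - epsL) / (2 * L * real N)"
    have e: "e > 0" using 2 L_pos N_pos by (simp add: e_def)
    \<comment> \<open>Integrability and radius are recorded together with the cover, so that one
      choice over \<open>i\<close> yields \<open>m\<close> and \<open>g\<close> with all the
      properties.\<close>
    have "\<exists>mi gi. (\<exists>(\<phi> :: 'a \<Rightarrow> 'e) nrm S \<CC>.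
          BSSa'_i (X i) (d i) (M i) mi gi \<phi> nrm S \<CC> \<or> BSSb_i (X i) (d i) (M i) mi gi \<phi> nrm S \<CC>)
        \<and> (\<forall>j<mi. integrable (M i) (gi j)) \<and> Wbar (d i) (M i) gi mi \<le> 2 * e" if i: "i < N" for i
    proof -
      interpret c: compact_metric_measure "X i" "d i" "M i" by (rule cm[OF i])
      obtain \<phi> :: "'a \<Rightarrow> 'e" and nrm S \<CC> mi gi where eta: "eta nrm \<CC> \<le> e"
        and B: "BSSa'_i (X i) (d i) (M i) mi gi \<phi> nrm S \<CC> \<or> BSSb_i (X i) (d i) (M i) mi gi \<phi> nrm S \<CC>"
        using 2(1) i e by blast
      have "(\<forall>j<mi. integrable (M i) (gi j)) \<and> Wbar (d i) (M i) gi mi \<le> 2 * eta nrm \<CC>"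
        using B
      proof
        assume a: "BSSa'_i (X i) (d i) (M i) mi gi \<phi> nrm S \<CC>"
        show ?thesis using c.BSSa'_props[OF ps[OF i] a] by simp
      next
        assume b: "BSSb_i (X i) (d i) (M i) mi gi \<phi> nrm S \<CC>"
        show ?thesis using c.BSSb_props[OF ps[OF i] b] by simp
      qed
      then have "(\<forall>j<mi. integrable (M i) (gi j)) \<and> Wbar (d i) (M i) gi mi \<le> 2 * e"
        using eta by (elim conjE, intro conjI) (assumption, linarith)
      then show ?thesis using B by blast
    qed
    then obtain m g where mg: "\<And>i. i < N \<Longrightarrow> \<exists>(\<phi> :: 'a \<Rightarrow> 'e) nrm S \<CC>.
          BSSa'_i (X i) (d i) (M i) (m i) (g i) \<phi> nrm S \<CC> \<or> BSSb_i (X i) (d i) (M i) (m i) (g i) \<phi> nrm S \<CC>"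
      and gint: "\<And>i j. i < N \<Longrightarrow> j < m i \<Longrightarrow> integrable (M i) (g i j)"
      and W: "\<And>i. i < N \<Longrightarrow> Wbar (d i) (M i) (g i) (m i) \<le> 2 * e"
      by metis
    show ?case
    proof (intro exI[of _ m] exI[of _ g] conjI allI impI)
      fix Or aUB aLB mut epsSub
      assume A: "is_oracle (PiE {..<N} X) N m g f Or \<and>
        alg2_output N X d M m g f Or epsL aUB aLB mut epsSub"
      have "epsSub \<le> epsL + L * (\<Sum>i<N. Wbar (d i) (M i) (g i) (m i))"
        by (rule alg2_output_bounds(5)[OF cm ps L_pos lip gint conjunct1[OF A] conjunct2[OF A]])
      also have "\<dots> \<le> epsL + L * (\<Sum>i<N. 2 * e)"
        using L_pos W by (intro add_left_mono mult_left_mono sum_mono) simp_all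
      also have "\<dots> = \<epsilon>" using L_pos N_pos by (simp add: e_def field_simps)
      finally show "epsSub \<le> \<epsilon>" .
    qed (rule mg)
  qed
qed

end
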